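(* Let $d\ge 1$ and let $\mathcal{K},\mathcal{K}'$ be admissible $d$-complexes. Let $F$ be an oriented facet of $\mathcal{K}$ with vertices $v_0,\dots,v_d$ and $F'$ an oriented facet of $\mathcal{K}'$ with vertices $v'_0,\dots,v'_d$, labelled so that $F=[v_0,\dots,v_d]$ and $F'=-[v'_0,\dots,v'_d]$. Form the connected sum $\mathcal{K}\#\mathcal{K}'$ by starting with $\mathcal{K}\sqcup\mathcal{K}'$, identifying $v_i$ with $v'_i$ for each $i=0,\dots,d$, and deleting $F$ and $F'$. Then $$V_{\mathbb{Q}}(\mathcal{K}\#\mathcal{K}') = V_{\mathbb{Q}}(\mathcal{K})+V_{\mathbb{Q}}(\mathcal{K}').$$
   Context: An admissible $d$-complex is a finite pure simplicial $d$-complex $\mathcal{K}$ (every simplex is a face of a $d$-simplex of $\mathcal{K}$) in which each facet ($d$-simplex) is equipped with an orientation, giving oriented facets $F_1,\dots,F_n$ (each facet occurring once), such that $\sum_i\partial F_i=0$. We also write $\mathcal{K}$ for the $d$-chain $\sum_i F_i$. For $\mathbb{F}\in\{\mathbb{Z},\mathbb{Q}\}$, $C_n(\mathcal{K};\mathbb{F})$ denotes the group of $n$-chains, with coefficients in $\mathbb{F}$, of oriented $n$-simplices on the vertices of $\mathcal{K}$: any $n+1$ distinct vertices of $\mathcal{K}$ span an allowed $n$-simplex, whether or not it is a simplex of $\mathcal{K}$, and an oriented simplex with reversed orientation equals minus the original. The boundary is $\partial[v_0,\dots,v_n]=\sum_i(-1)^i[v_0,\dots,\widehat{v_i},\dots,v_n]$.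 For a chain $\alpha$, $|\alpha|_1$ is the sum of the absolute values of its coefficients (with one chosen orientation per simplex). Define $V_{\mathbb{F}}(\mathcal{K})$ to be the minimum of $|\alpha|_1$ over all $\alpha\in C_{d+1}(\mathcal{K};\mathbb{F})$ with $\partial\alpha=\mathcal{K}$. The disjoint union $\mathcal{K}\sqcup\mathcal{K}'$ has as vertex set the disjoint union of the two vertex sets and as oriented facets those of $\mathcal{K}$ together with those of $\mathcal{K}'$. Thus $\mathcal{K}\#\mathcal{K}'$ is the admissible $d$-complex whose vertices are those of $\mathcal{K}$ and $\mathcal{K}'$ after the identification, and whose oriented facets are those of $\mathcal{K}$ other than $F$ and those of $\mathcal{K}'$ other than $F'$. *)

theory Defs
  imports Complex_Main "HOL-Combinatorics.Permutations"
begin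

text \<open>
  An oriented simplex is an equivalence class of orderings of its vertices (distinct lists)
  modulo even permutations; \<open>osimplex [v\<^sub>0, \<dots>, v\<^sub>n]\<close> is the class of
  \<open>[v\<^sub>0, \<dots>, v\<^sub>n]\<close>. For a single vertex there is only one class, and then
  \<open>opposite\<close> yields the empty set, which is not an oriented simplex.
\<close>

type_synonym 'a osimp = "'a list set"

definition osimplex :: "'a list \<Rightarrow> 'a osimp" where
  "osimplex vs = {permute_list p vs | p. p permutes {..<length vs} \<and> evenperm p}"

definition opposite :: "'a osimp \<Rightarrow> 'a osimp" where
  "opposite F = {permute_list p vs | p vs. vs \<in> F \<and> p permutes {..<length vs} \<and> \<not> evenperm p}"

text \<open>
  An \<open>n\<close>-chain is encoded by its coefficients as an alternating function: \<open>c vs\<close> is the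
  coefficient of the oriented simplex \<open>osimplex vs\<close>, so that reordering the vertices multiplies
  the coefficient by the sign of the permutation.
\<close>

type_synonym ('a, 'f) chain = "'a list \<Rightarrow> 'f"

definition chains :: "nat \<Rightarrow> 'a set \<Rightarrow> ('a, 'f :: linordered_idom) chain set" where
  "chains n V = {c.
     (\<forall>vs. c vs \<noteq> 0 \<longrightarrow> distinct vs \<and> length vs = n + 1 \<and> set vs \<subseteq> V) \<and>
     (\<forall>vs p. p permutes {..<length vs} \<longrightarrow> c (permute_list p vs) = of_int (sign p) * c vs)}"

definition simplex_chain :: "'a osimp \<Rightarrow> ('a, 'f :: linordered_idom) chain" where
  "simplex_chain F = (\<lambda>vs. if vs \<in> F then 1 else if vs \<in> opposite F then -1 else 0)"

text \<open>
  One orientation of each simplex is chosen by fixing an ordering of its vertices. The chain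
  \<open>c\<close> is then the sum of \<open>c (ordering S)\<close> times the simplex \<open>osimplex (ordering S)\<close>,
  with \<open>S\<close> ranging over \<open>support c\<close>; on alternating functions nothing below depends on
  the choice.
\<close>

definition ordering :: "'a set \<Rightarrow> 'a list" where
  "ordering S = (SOME vs. distinct vs \<and> set vs = S)"

definition support :: "('a, 'f :: linordered_idom) chain \<Rightarrow> 'a set set" where
  "support c = set ` {vs. c vs \<noteq> 0}"

definition simplex_boundary :: "'a list \<Rightarrow> ('a, 'f :: linordered_idom) chain" where
  "simplex_boundary vs = (\<lambda>ws.
     \<Sum>i<length vs. (-1) ^ i * simplex_chain (osimplex (take i vs @ drop (Suc i) vs)) ws)"

definition boundary :: "('a, 'f :: linordered_idom) chain \<Rightarrow> ('a, 'f) chain" where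
  "boundary c = (\<lambda>ws. \<Sum>S\<in>support c. c (ordering S) * simplex_boundary (ordering S) ws)"

definition l1_norm :: "('a, 'f :: linordered_idom) chain \<Rightarrow> 'f" where
  "l1_norm c = (\<Sum>S\<in>support c. \<bar>c (ordering S)\<bar>)"

record 'a ocomplex =
  simplices :: "'a set set"
  oriented_facets :: "'a osimp set"

definition vertices :: "'a ocomplex \<Rightarrow> 'a set" where
  "vertices K = \<Union> (simplices K)"

definition simplicial_complex :: "'a set set \<Rightarrow> bool" where
  "simplicial_complex \<Delta> \<longleftrightarrow>
     (\<forall>S\<in>\<Delta>. finite S \<and> S \<noteq> {}) \<and> (\<forall>S\<in>\<Delta>. \<forall>T. T \<subseteq> S \<and> T \<noteq> {} \<longrightarrow> T \<in> \<Delta>)"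

definition pure_complex :: "nat \<Rightarrow> 'a set set \<Rightarrow> bool" where
  "pure_complex d \<Delta> \<longleftrightarrow> (\<forall>S\<in>\<Delta>. \<exists>T\<in>\<Delta>. S \<subseteq> T \<and> card T = d + 1)"

definition admissible :: "nat \<Rightarrow> 'a ocomplex \<Rightarrow> bool" where
  "admissible d K \<longleftrightarrow>
     finite (simplices K) \<and> simplicial_complex (simplices K) \<and> pure_complex d (simplices K) \<and>
     (\<forall>F\<in>oriented_facets K. \<exists>vs. distinct vs \<and> length vs = d + 1 \<and>
        set vs \<in> simplices K \<and> F = osimplex vs) \<and>
     (\<forall>S\<in>simplices K. card S = d + 1 \<longrightarrow>
        (\<exists>!F. F \<in> oriented_facets K \<and> (\<exists>vs\<in>F. set vs = S))) \<and>
     (\<forall>ws. (\<Sum>F\<in>oriented_facets K. boundary (simplex_chain F :: ('a, int) chain) ws) = 0)"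

definition complex_chain :: "'a ocomplex \<Rightarrow> ('a, 'f :: linordered_idom) chain" where
  "complex_chain K = (\<lambda>vs. \<Sum>F\<in>oriented_facets K. simplex_chain F vs)"

text \<open>The coefficient ring is determined by the result type.\<close>

definition filling_volume :: "nat \<Rightarrow> 'a ocomplex \<Rightarrow> 'f :: linordered_idom" where
  "filling_volume d K =
     (LEAST r. \<exists>\<alpha> \<in> chains (d + 1) (vertices K). boundary \<alpha> = complex_chain K \<and> r = l1_norm \<alpha>)"

definition map_osimp :: "('a \<Rightarrow> 'b) \<Rightarrow> 'a osimp \<Rightarrow> 'b osimp" where
  "map_osimp f F = map f ` F"

definition disjoint_union :: "'a ocomplex \<Rightarrow> 'b ocomplex \<Rightarrow> ('a + 'b) ocomplex" where
  "disjoint_union K K' =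
     \<lparr>simplices = (\<lambda>S. Inl ` S) ` simplices K \<union> (\<lambda>S. Inr ` S) ` simplices K',
      oriented_facets =
        map_osimp Inl ` oriented_facets K \<union> map_osimp Inr ` oriented_facets K'\<rparr>"

text \<open>
  The quotient map of the disjoint union, sending a vertex to its class under the equivalence
  relation generated by identifying the \<open>i\<close>-th entry of \<open>vs\<close> with the \<open>i\<close>-th entry of
  \<open>vs'\<close>.
\<close>

definition glue :: "'a list \<Rightarrow> 'b list \<Rightarrow> 'a + 'b \<Rightarrow> ('a + 'b) set" where
  "glue vs vs' x =
     (let R = {(Inl v, Inr v') | v v'. (v, v') \<in> set (zip vs vs')} in (R \<union> R\<inverse>)\<^sup>* `` {x})"

text \<open>
  The facets \<open>F = osimplex vs\<close> and \<open>F' = opposite (osimplex vs')\<close> become the same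
  unoriented simplex, which is removed from the set of simplices, while its proper faces remain.
\<close>

definition connected_sum ::
    "'a ocomplex \<Rightarrow> 'a list \<Rightarrow> 'b ocomplex \<Rightarrow> 'b list \<Rightarrow> ('a + 'b) set ocomplex" where
  "connected_sum K vs K' vs' =
     (let q = glue vs vs'; U = disjoint_union K K' in
      \<lparr>simplices = (\<lambda>S. q ` S) ` simplices U - {q ` Inl ` set vs},
       oriented_facets = map_osimp q ` (oriented_facets U -
         {map_osimp Inl (osimplex vs), map_osimp Inr (opposite (osimplex vs'))})\<rparr>)"

end

theory Submission
  imports Defs "HOL-Combinatorics.Multiset_Permutations"
begin

text \<open>
  Let \<open>j\<close> and \<open>j'\<close> be the inclusions of the two vertex sets into the vertex set of the connected
  sum. The facets \<open>F\<close> and \<open>F'\<close> become opposite simplices, so the chain of the connected sum is the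
  sum of the push-forwards of the two given cycles (\<open>complex_chain_connected_sum\<close>). The images of
  \<open>j\<close> and \<open>j'\<close> meet in the vertices of the common simplex.

  Pushing forward a filling of each cycle and adding up fills the connected sum, which gives one
  inequality. For the other one, take the retraction \<open>r\<close> to the first vertex set that sends all
  remaining vertices of the second complex to the vertex \<open>vs ! 0\<close>, and the retraction \<open>r'\<close> to the
  second vertex set that sends all remaining vertices of the first complex to \<open>vs' ! 1\<close>. If \<open>\<beta>\<close>
  fills the connected sum, then its image under \<open>r\<close> fills the first cycle: the second cycle is
  sent to a \<open>d\<close>-cycle on the \<open>d + 1\<close> vertices of a simplex, and such a cycle is zero
  (\<open>push_collapse_filling\<close>). Likewise the image under \<open>r'\<close> fills the second cycle. As \<open>vs ! 0\<close> and
  \<open>vs' ! 1\<close> are different vertices of the common simplex, a counting argument shows that each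
  \<open>(d + 1)\<close>-simplex is made degenerate by \<open>r\<close> or by \<open>r'\<close> (\<open>collapse_both_not_injective\<close>). Hence
  the norms of the two images add up to at most the norm of \<open>\<beta>\<close> (\<open>minimal_filling_glue\<close>).

  The filling volume is a least value, so its existence has to be shown for the two given
  complexes. A cone is a filling, and a filling with least norm exists over any ordered field by an
  extreme point argument (\<open>l1_minimum_attained\<close>).

  All computations with chains rest on two descriptions that do not choose an ordering of each
  simplex: \<open>boundary_eq\<close>, by which the boundary of \<open>c\<close> is \<open>\<Sum>v\<in>V. c (v # ws)\<close>, and
  \<open>sum_abs_eq_l1_norm\<close>, by which the \<open>l\<^sub>1\<close> norm is, up to a factorial, the sum of absolute values
  over all vertex lists.
\<close>

section \<open>Alternating functions and chains\<close>

text \<open>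
  Alternation, stated for adjacent entries only. For chains this is equivalent to the sign rule for
  all permutations (lemma \<open>chains_iff\<close>), and it is the form that induction over lists can use.
\<close>
definition alternating :: "('a list \<Rightarrow> 'f :: linordered_idom) \<Rightarrow> bool" where
  "alternating c \<longleftrightarrow> (\<forall>xs a b ys. c (xs @ a # b # ys) = - c (xs @ b # a # ys))"

lemma alternatingD: "alternating c \<Longrightarrow> c (xs @ a # b # ys) = - c (xs @ b # a # ys)"
  unfolding alternating_def by blast

lemma alternating_swap_head: "alternating c \<Longrightarrow> c (a # b # ys) = - c (b # a # ys)"
  using alternatingD[of c "[]" a b ys] by (simp only: append_Nil)

lemma alternating_Cons: "alternating c \<Longrightarrow> alternating (\<lambda>u. c (v # u))"
  unfolding alternating_def by (metis append_Cons)

lemma alternating_append: "alternating c \<Longrightarrow> alternating (\<lambda>u. c (xs @ u))"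
  unfolding alternating_def by (metis append_assoc)

lemma alternating_move:
  "alternating c \<Longrightarrow> c (x # xs @ ys) = (-1) ^ length xs * c (xs @ x # ys)"
proof (induction xs arbitrary: c)
  case (Cons y xs)
  have "c (x # y # xs @ ys) = - c (y # x # xs @ ys)"
    by (rule alternating_swap_head[OF Cons.prems])
  also have "c (y # x # xs @ ys) = (-1) ^ length xs * c (y # xs @ x # ys)"
    by (rule Cons.IH[OF alternating_Cons[OF Cons.prems]])
  finally show ?case by simp
qed simp

lemma alternating_exchange:
  assumes "alternating c"
  shows "c (xs @ a # zs @ b # ys) = - c (xs @ b # zs @ a # ys)"
proof -
  define e where "e = (\<lambda>u. c (xs @ u))"
  have e: "alternating e"
    unfolding e_def by (rule alternating_append[OF assms])
  have "e (a # zs @ b # ys) = (-1) ^ length zs * e (zs @ a # b # ys)"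
    by (rule alternating_move[OF e])
  also have "e (zs @ a # b # ys) = - e (zs @ b # a # ys)"
    by (rule alternatingD[OF e])
  also have "(-1) ^ length zs * - e (zs @ b # a # ys) = - ((-1) ^ length zs * e (zs @ b # a # ys))"
    by simp
  also have "(-1) ^ length zs * e (zs @ b # a # ys) = e (b # zs @ a # ys)"
    by (rule alternating_move[OF e, symmetric])
  finally show ?thesis by (simp add: e_def)
qed

lemma alternating_nondistinct:
  assumes "alternating c" "\<not> distinct us"
  shows "c us = 0"
proof -
  obtain xs a zs ys where "us = xs @ a # zs @ a # ys"
    using not_distinct_decomp[OF assms(2)] by auto
  then have "c us = - c us"
    using alternating_exchange[OF assms(1)] by metis
  then show ?thesis by simp
qed

lemma permute_list_transpose:
  assumes "i = length xs" "j = Suc (length xs + length zs)"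
  shows "permute_list (transpose i j) (xs @ a # zs @ b # ys) = xs @ b # zs @ a # ys"
proof (rule nth_equalityI)
  fix k
  assume "k < length (permute_list (transpose i j) (xs @ a # zs @ b # ys))"
  then have nth: "permute_list (transpose i j) (xs @ a # zs @ b # ys) ! k
      = (xs @ a # zs @ b # ys) ! transpose i j k"
    by (simp only: permute_list_def length_map length_upt diff_zero nth_map nth_upt add_0)
  consider "k < i" | "k = i" | m where "k = Suc (i + m)" "m < length zs" | "k = j"
    | m where "k = Suc (j + m)"
  proof -
    have "k = Suc (i + (k - Suc i))" if "i < k" using that by simp
    moreover have "k = Suc (j + (k - Suc j))" if "j < k" using that by simp
    moreover have "k - Suc i < length zs" if "i < k" "k < j" using that assms by simp
    ultimately show ?thesis using that by (metis linorder_neqE_nat)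
  qed
  then show "permute_list (transpose i j) (xs @ a # zs @ b # ys) ! k = (xs @ b # zs @ a # ys) ! k"
    unfolding nth using assms by cases (simp_all add: transpose_def nth_append)
qed simp

text \<open>
  Adjacent exchanges generate all transpositions (lemma \<open>alternating_exchange\<close>), and these
  generate all permutations.
\<close>
lemma alternating_permute_list:
  assumes "alternating c" "p permutes {..<length vs}"
  shows "c (permute_list p vs) = of_int (sign p) * c vs"
proof -
  have exch: "c (permute_list (transpose i j) us) = - c us" if "i < j" "j < length us" for i j us
  proof -
    \<comment> \<open>Cut \<open>us\<close> at the positions \<open>i\<close> and \<open>j\<close>.\<close>
    define xs where "xs = take i us"
    define zs where "zs = take (j - Suc i) (drop (Suc i) us)"
    define ys where "ys = drop (Suc j) us"
    have us: "us = xs @ us ! i # zs @ us ! j # ys"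
    proof -
      have "drop (Suc i) us = zs @ drop (j - Suc i) (drop (Suc i) us)"
        by (simp add: zs_def del: drop_drop)
      also have "drop (j - Suc i) (drop (Suc i) us) = us ! j # ys"
        using that by (simp add: ys_def Cons_nth_drop_Suc)
      finally show ?thesis
        using that by (simp add: xs_def id_take_nth_drop[symmetric]) (metis id_take_nth_drop less_trans)
    qed
    have "i = length xs" "j = Suc (length xs + length zs)"
      using that by (auto simp: xs_def zs_def)
    then have "permute_list (transpose i j) us = xs @ us ! j # zs @ us ! i # ys"
      using permute_list_transpose us by metis
    then show ?thesis
      using us alternating_exchange[OF assms(1)] by metis
  qed
  have exch': "c (permute_list (transpose i j) us) = - c us"
    if "i \<noteq> j" "i < length us" "j < length us" for i j us
    using that exch[of i j us] exch[of j i us] by (metis linorder_neqE_nat transpose_commute)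
  have "finite {..<length vs}" by simp
  from this assms(2) show ?thesis
  proof (induction p rule: permutes_rev_induct)
    case (swap i j p)
    have t: "transpose i j permutes {..<length vs}"
      using swap by (simp add: permutes_swap_id)
    have "c (permute_list (p \<circ> transpose i j) vs)
        = c (permute_list (transpose i j) (permute_list p vs))"
      by (simp add: permute_list_compose[OF t])
    also have "\<dots> = - c (permute_list p vs)"
      using swap by (intro exch') auto
    also have "sign (p \<circ> transpose i j) = - sign p"
      using swap t by (simp add: sign_compose sign_swap_id permutation_swap_id permutes_imp_permutation[of "{..<length vs}"])
    ultimately show ?case using swap.IH by (simp only: of_int_minus mult_minus_left)
  qed simp
qed

lemma chains_iff:
  "c \<in> chains n V \<longleftrightarrow>
     alternating c \<and> (\<forall>vs. c vs \<noteq> 0 \<longrightarrow> length vs = n + 1 \<and> set vs \<subseteq> V)"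
proof
  assume c: "c \<in> chains n V"
  have "c (xs @ a # b # ys) = - c (xs @ b # a # ys)" for xs a b ys
  proof -
    define i where "i = length xs"
    let ?t = "transpose i (Suc i)" and ?vs = "xs @ b # a # ys"
    have "permute_list ?t ?vs = xs @ a # b # ys"
      using permute_list_transpose[of i xs "Suc i" "[]" b a ys] by (simp add: i_def)
    moreover have "?t permutes {..<length ?vs}"
      by (rule permutes_swap_id) (auto simp: i_def)
    moreover have "\<forall>us p. p permutes {..<length us} \<longrightarrow> c (permute_list p us) = of_int (sign p) * c us"
      using c by (simp add: chains_def)
    ultimately have "c (xs @ a # b # ys) = of_int (sign ?t) * c ?vs"
      by metis
    then show ?thesis by (simp add: sign_swap_id)
  qed
  then have "alternating c"
    unfolding alternating_def by blast
  then show "alternating c \<and> (\<forall>vs. c vs \<noteq> 0 \<longrightarrow> length vs = n + 1 \<and> set vs \<subseteq> V)"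
    using c by (simp add: chains_def)
next
  assume c: "alternating c \<and> (\<forall>vs. c vs \<noteq> 0 \<longrightarrow> length vs = n + 1 \<and> set vs \<subseteq> V)"
  then show "c \<in> chains n V"
    unfolding chains_def using alternating_nondistinct alternating_permute_list by blast
qed

lemma chainsI:
  assumes "alternating c" "\<And>vs. c vs \<noteq> 0 \<Longrightarrow> length vs = n + 1 \<and> set vs \<subseteq> V"
  shows "c \<in> chains n V"
  using assms by (auto simp: chains_iff)

lemma chains_alternating: "c \<in> chains n V \<Longrightarrow> alternating c"
  by (simp add: chains_iff)

lemma chains_support: "c \<in> chains n V \<Longrightarrow> c vs \<noteq> 0 \<Longrightarrow> length vs = n + 1 \<and> set vs \<subseteq> V"
  by (auto simp: chains_iff)

lemma alternating_sum:
  assumes "\<And>i. i \<in> I \<Longrightarrow> alternating (c i)"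
  shows "alternating (\<lambda>u. \<Sum>i\<in>I. c i u)"
  unfolding alternating_def
proof (intro allI)
  fix xs ys :: "'b list" and a b
  have "(\<Sum>i\<in>I. c i (xs @ a # b # ys)) = (\<Sum>i\<in>I. - c i (xs @ b # a # ys))"
    by (rule sum.cong[OF refl alternatingD[OF assms]])
  then show "(\<Sum>i\<in>I. c i (xs @ a # b # ys)) = - (\<Sum>i\<in>I. c i (xs @ b # a # ys))"
    by (simp only: sum_negf)
qed

lemma alternating_lincomb:
  assumes "alternating c" "alternating e"
  shows "alternating (\<lambda>u. c u + t * e u)"
  unfolding alternating_def
proof (intro allI)
  fix xs ys :: "'a list" and a b
  show "c (xs @ a # b # ys) + t * e (xs @ a # b # ys)
      = - (c (xs @ b # a # ys) + t * e (xs @ b # a # ys))"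
    unfolding alternatingD[OF assms(1), of xs a b ys] alternatingD[OF assms(2), of xs a b ys]
    by simp
qed

lemma chains_lincomb:
  assumes "c \<in> chains n V" "e \<in> chains n V"
  shows "(\<lambda>u. c u + t * e u) \<in> chains n V"
proof (rule chainsI)
  show "alternating (\<lambda>u. c u + t * e u)"
    using assms by (intro alternating_lincomb chains_alternating)
  show "length u = n + 1 \<and> set u \<subseteq> V" if "c u + t * e u \<noteq> 0" for u
    using that chains_support[OF assms(1), of u] chains_support[OF assms(2), of u]
    by (cases "c u = 0") auto
qed

lemma chains_sum:
  assumes "\<And>i. i \<in> I \<Longrightarrow> c i \<in> chains n V"
  shows "(\<lambda>u. \<Sum>i\<in>I. c i u) \<in> chains n V"
proof (rule chainsI)
  show "alternating (\<lambda>u. \<Sum>i\<in>I. c i u)"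
    using assms by (intro alternating_sum chains_alternating)
  show "length u = n + 1 \<and> set u \<subseteq> V" if "(\<Sum>i\<in>I. c i u) \<noteq> 0" for u
  proof -
    obtain i where "i \<in> I" "c i u \<noteq> 0"
      using \<open>(\<Sum>i\<in>I. c i u) \<noteq> 0\<close> by (rule sum.not_neutral_contains_not_neutral)
    then show ?thesis using assms chains_support by blast
  qed
qed

section \<open>Oriented simplices as chains\<close>

lemma permute_list_inj:
  assumes "distinct vs" "p permutes {..<length vs}" "q permutes {..<length vs}"
    "permute_list p vs = permute_list q vs"
  shows "p = q"
proof
  fix i
  show "p i = q i"
  proof (cases "i < length vs")
    case True
    then have "vs ! p i = vs ! q i"
      using assms(2-4) by (metis permute_list_nth)
    moreover have "p i < length vs" "q i < length vs"
      using True assms(2,3) permutes_in_image by fastforce+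
    ultimately show ?thesis using assms(1) by (simp add: nth_eq_iff_index_eq)
  next
    case False
    then show ?thesis using assms(2,3) by (simp add: permutes_not_in)
  qed
qed

lemma permutation_lessThan: "p permutes {..<n::nat} \<Longrightarrow> permutation p"
  by (rule permutes_imp_permutation[of "{..<n}"]) auto

lemma osimplex_refl: "vs \<in> osimplex vs"
  unfolding osimplex_def by (auto intro!: exI[of _ id] simp: permutes_id)

lemma permute_list_in_osimplex:
  assumes "distinct vs" "p permutes {..<length vs}"
  shows "permute_list p vs \<in> osimplex vs \<longleftrightarrow> evenperm p"
  using permute_list_inj[OF assms] assms(2) by (auto simp: osimplex_def)

lemma permute_list_in_opposite:
  assumes "distinct vs" "p permutes {..<length vs}"
  shows "permute_list p vs \<in> opposite (osimplex vs) \<longleftrightarrow> \<not> evenperm p"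
proof
  assume "permute_list p vs \<in> opposite (osimplex vs)"
  then obtain q us where q: "permute_list p vs = permute_list q us" "us \<in> osimplex vs"
      "q permutes {..<length us}" "\<not> evenperm q"
    unfolding opposite_def by blast
  then obtain r where r: "us = permute_list r vs" "r permutes {..<length vs}" "evenperm r"
    unfolding osimplex_def by blast
  have q': "q permutes {..<length vs}" using q r by simp
  have "permute_list p vs = permute_list (r \<circ> q) vs"
    using q r q' by (simp add: permute_list_compose)
  then have "p = r \<circ> q"
    by (rule permute_list_inj[OF assms permutes_compose[OF q' r(2)]])
  then show "\<not> evenperm p"
    using q r q' by (simp add: evenperm_comp permutation_lessThan)
next
  assume "\<not> evenperm p"
  then show "permute_list p vs \<in> opposite (osimplex vs)"
    unfolding opposite_def using assms(2) osimplex_refl by blast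
qed

lemma simplex_chain_permute:
  assumes "distinct vs" "p permutes {..<length vs}"
  shows "simplex_chain (osimplex vs) (permute_list p vs) = of_int (sign p)"
  using assms by (simp add: simplex_chain_def permute_list_in_osimplex permute_list_in_opposite sign_def)

lemma simplex_chain_self: "simplex_chain (osimplex vs) vs = 1"
  by (simp add: simplex_chain_def osimplex_refl)

lemma mset_osimplex: "ws \<in> osimplex vs \<Longrightarrow> mset ws = mset vs"
  by (auto simp: osimplex_def)

lemma mset_opposite: "ws \<in> opposite (osimplex vs) \<Longrightarrow> mset ws = mset vs"
  by (auto simp: opposite_def dest!: mset_osimplex)

lemma simplex_chain_nonzero: "simplex_chain (osimplex vs) ws \<noteq> 0 \<Longrightarrow> mset ws = mset vs"
  by (auto simp: simplex_chain_def dest: mset_osimplex mset_opposite split: if_splits)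

lemma simplex_chain_chains:
  assumes "distinct vs" "length vs = n + 1" "set vs \<subseteq> V"
  shows "(simplex_chain (osimplex vs) :: ('a, 'f :: linordered_idom) chain) \<in> chains n V"
proof -
  have "simplex_chain (osimplex vs) (permute_list q us)
      = of_int (sign q) * (simplex_chain (osimplex vs) us :: 'f)"
    if q: "q permutes {..<length us}" for q us
  proof (cases "mset us = mset vs")
    case True
    then obtain p where p: "p permutes {..<length vs}" "us = permute_list p vs"
      by (metis mset_eq_permutation)
    have q': "q permutes {..<length vs}" using q p by simp
    have "permute_list q us = permute_list (p \<circ> q) vs"
      using p q' by (simp add: permute_list_compose)
    then show ?thesis
      using p q' assms(1)
      by (simp add: simplex_chain_permute permutes_compose sign_compose permutation_lessThan mult.commute)
  next
    case False
    then have "simplex_chain (osimplex vs) us = (0::'f)"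
      using simplex_chain_nonzero by blast
    moreover have "simplex_chain (osimplex vs) (permute_list q us) = (0::'f)"
      using False simplex_chain_nonzero[of vs "permute_list q us"] q by auto
    ultimately show ?thesis by simp
  qed
  moreover have "distinct us \<and> length us = n + 1 \<and> set us \<subseteq> V"
    if "simplex_chain (osimplex vs) us \<noteq> (0 :: 'f)" for us
    using simplex_chain_nonzero[OF that] assms
    by (metis mset_eq_setD mset_eq_length mset_eq_imp_distinct_iff)
  ultimately show ?thesis
    unfolding chains_def by blast
qed

text \<open>
  An alternating function is determined on the orderings of a simplex by its value at one of them,
  so there it is that value times the chain of the oriented simplex.
\<close>
lemma alternating_mult_simplex_chain:
  assumes "alternating c" "distinct vs"
  shows "c vs * simplex_chain (osimplex vs) ws = (if mset ws = mset vs then c ws else 0)"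
proof (cases "mset ws = mset vs")
  case True
  then obtain p where p: "p permutes {..<length vs}" "ws = permute_list p vs"
    by (metis mset_eq_permutation)
  then show ?thesis
    using True assms by (simp add: simplex_chain_permute alternating_permute_list mult.commute)
next
  case False
  then have "simplex_chain (osimplex vs) ws = (0 :: 'b)"
    using simplex_chain_nonzero by blast
  then show ?thesis using False by simp
qed

lemma abs_alternating_mset:
  assumes "alternating c" "mset us = mset vs"
  shows "\<bar>c us\<bar> = \<bar>c vs\<bar>"
proof -
  obtain p where p: "p permutes {..<length vs}" "us = permute_list p vs"
    using assms(2) by (metis mset_eq_permutation)
  then show ?thesis
    using assms(1) by (simp add: alternating_permute_list abs_mult flip: of_int_abs)
qed

section \<open>The boundary formula\<close>

lemma ordering: "finite S \<Longrightarrow> distinct (ordering S) \<and> set (ordering S) = S"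
  unfolding ordering_def by (rule someI_ex) (metis finite_distinct_list)

lemma support_subset:
  assumes "c \<in> chains n V"
  shows "support c \<subseteq> {S. S \<subseteq> V \<and> finite S \<and> card S = n + 1}"
  using assms by (auto simp: support_def chains_def distinct_card)

lemma finite_support: "c \<in> chains n V \<Longrightarrow> finite V \<Longrightarrow> finite (support c)"
  by (rule finite_subset[OF support_subset]) auto

text \<open>
  The coefficient of \<open>ws\<close> in the boundary collects the simplices obtained by adding one vertex in
  front. This removes the chosen orderings from the boundary: it becomes a plain sum over vertices,
  and the alternating signs are absorbed by moving the deleted vertex to the front.
\<close>
lemma boundary_eq:
  assumes c: "c \<in> chains n V" and V: "finite V"
  shows "boundary c ws = (\<Sum>v\<in>V. c (v # ws))"
proof -
  have alt: "alternating c" using c by (rule chains_alternating)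
  have one: "c (ordering S) * simplex_boundary (ordering S) ws
      = (\<Sum>v\<in>V. if set (v # ws) = S then c (v # ws) else 0)" if S: "S \<in> support c" for S
  proof -
    define vs where "vs = ordering S"
    have fS: "S \<subseteq> V" "finite S" using support_subset[OF c] S by auto
    have vs: "distinct vs" "set vs = S" using ordering[OF fS(2)] by (auto simp: vs_def)
    define face where "face i = take i vs @ drop (Suc i) vs" for i
    have dec: "vs = take i vs @ vs ! i # drop (Suc i) vs" if "i < length vs" for i
      using that by (rule id_take_nth_drop)
    have coeff: "c vs * ((-1) ^ i * simplex_chain (osimplex (face i)) ws)
        = (if set (vs ! i # ws) = S then c (vs ! i # ws) else 0)" if i: "i < length vs" for i
    proof -
      have dv: "distinct (take i vs @ vs ! i # drop (Suc i) vs)" using dec[OF i] vs(1) by simp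
      have df: "distinct (face i)" using dv by (simp add: face_def)
      have ni: "vs ! i \<notin> set (face i)" using dv by (auto simp: face_def)
      have sf: "set vs = insert (vs ! i) (set (face i))"
        using arg_cong[OF dec[OF i], of set] by (simp add: face_def)
      have "c (vs ! i # face i) = (-1) ^ i * c vs"
        using alternating_move[OF alt, of "vs ! i" "take i vs" "drop (Suc i) vs"] i dec[OF i]
        by (simp add: face_def min_def)
      then have "c vs * ((-1) ^ i * simplex_chain (osimplex (face i)) ws)
        = c (vs ! i # face i) * simplex_chain (osimplex (face i)) ws"
        by (simp add: ac_simps)
      also have "\<dots> = (if mset ws = mset (face i) then c (vs ! i # ws) else 0)"
        by (rule alternating_mult_simplex_chain[OF alternating_Cons[OF alt] df])
      also have "\<dots> = (if set (vs ! i # ws) = S then c (vs ! i # ws) else 0)"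
      proof (cases "distinct (vs ! i # ws)")
        case True
        then have "mset ws = mset (face i) \<longleftrightarrow> set ws = set (face i)"
          using df by (simp add: set_eq_iff_mset_eq_distinct)
        also have "\<dots> \<longleftrightarrow> set (vs ! i # ws) = S"
          using True ni sf vs(2) by (simp add: insert_ident)
        finally show ?thesis by simp
      qed (simp add: alternating_nondistinct[OF alt])
      finally show ?thesis .
    qed
    have "c vs * simplex_boundary vs ws
        = (\<Sum>i<length vs. c vs * ((-1) ^ i * simplex_chain (osimplex (face i)) ws))"
      by (simp add: simplex_boundary_def sum_distrib_left face_def)
    also have "\<dots> = (\<Sum>i<length vs. if set (vs ! i # ws) = S then c (vs ! i # ws) else 0)"
      by (rule sum.cong) (auto simp only: coeff lessThan_iff)
    also have "\<dots> = (\<Sum>v\<in>S. if set (v # ws) = S then c (v # ws) else 0)"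
      using bij_betw_nth[OF vs(1), of "{..<length vs}" S] vs(2)
      by (intro sum.reindex_bij_betw) auto
    also have "\<dots> = (\<Sum>v\<in>V. if set (v # ws) = S then c (v # ws) else 0)"
      using V fS by (intro sum.mono_neutral_left) auto
    finally show ?thesis by (simp add: vs_def)
  qed
  have "boundary c ws = (\<Sum>S\<in>support c. \<Sum>v\<in>V. if set (v # ws) = S then c (v # ws) else 0)"
    by (simp add: boundary_def one)
  also have "\<dots> = (\<Sum>v\<in>V. \<Sum>S\<in>support c. if set (v # ws) = S then c (v # ws) else 0)"
    by (rule sum.swap)
  also have "\<dots> = (\<Sum>v\<in>V. c (v # ws))"
    using finite_support[OF c V]
    by (intro sum.cong) (auto simp: sum.delta support_def simp del: set_simps)
  finally show ?thesis .
qed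

section \<open>The \<open>l\<^sub>1\<close> norm as a sum over vertex lists\<close>

text \<open>
  The lists of length \<open>n\<close> with entries in \<open>V\<close>, repetitions allowed.
\<close>
definition lists_on :: "nat \<Rightarrow> 'a set \<Rightarrow> 'a list set" where
  "lists_on n V = {vs. set vs \<subseteq> V \<and> length vs = n}"

lemma finite_lists_on: "finite V \<Longrightarrow> finite (lists_on n V)"
  by (simp add: lists_on_def finite_lists_length_eq)

text \<open>
  Each \<open>n\<close>-simplex has \<open>(n + 1)!\<close> orderings, with coefficients of equal absolute value. Working
  with the sum over all lists avoids the choice of orderings in the \<open>l\<^sub>1\<close> norm.
\<close>
lemma sum_abs_eq_l1_norm:
  assumes c: "c \<in> chains n V" and V: "finite V"
  shows "(\<Sum>vs\<in>lists_on (n + 1) V. \<bar>c vs\<bar>) = fact (n + 1) * l1_norm c"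
proof -
  let ?A = "{vs \<in> lists_on (n + 1) V. c vs \<noteq> 0}"
  have fin: "finite ?A" using finite_lists_on[OF V] by simp
  have "(\<Sum>vs\<in>lists_on (n + 1) V. \<bar>c vs\<bar>) = (\<Sum>vs\<in>?A. \<bar>c vs\<bar>)"
    using finite_lists_on[OF V] by (intro sum.mono_neutral_right) auto
  also have "\<dots> = (\<Sum>S\<in>support c. \<Sum>vs | vs \<in> ?A \<and> set vs = S. \<bar>c vs\<bar>)"
    by (rule sum.group[symmetric]) (use fin finite_support[OF c V] in \<open>auto simp: support_def\<close>)
  also have "\<dots> = (\<Sum>S\<in>support c. fact (n + 1) * \<bar>c (ordering S)\<bar>)"
  proof (rule sum.cong[OF refl])
    fix S assume S: "S \<in> support c"
    have S': "S \<subseteq> V" "finite S" "card S = n + 1" using support_subset[OF c] S by auto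
    obtain ws where ws: "c ws \<noteq> 0" "set ws = S" using S by (auto simp: support_def)
    have dws: "distinct ws" using c ws by (auto simp: chains_def)
    have abs_eq: "\<bar>c vs\<bar> = \<bar>c ws\<bar>" if "distinct vs" "set vs = S" for vs
      by (rule abs_alternating_mset[OF chains_alternating[OF c]])
        (use that ws dws set_eq_iff_mset_eq_distinct[of vs ws] in simp)
    have eq: "{vs. vs \<in> ?A \<and> set vs = S} = permutations_of_set S"
    proof (intro set_eqI iffI)
      fix vs assume "vs \<in> {vs. vs \<in> ?A \<and> set vs = S}"
      then show "vs \<in> permutations_of_set S"
        using c by (auto simp: chains_def)
    next
      fix vs assume "vs \<in> permutations_of_set S"
      then have "distinct vs" "set vs = S" by (auto dest: permutations_of_setD)
      moreover from this have "c vs \<noteq> 0" using abs_eq[of vs] ws by auto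
      ultimately show "vs \<in> {vs. vs \<in> ?A \<and> set vs = S}"
        using S' by (auto simp: lists_on_def distinct_card[symmetric])
    qed
    have "(\<Sum>vs | vs \<in> ?A \<and> set vs = S. \<bar>c vs\<bar>) = (\<Sum>vs\<in>permutations_of_set S. \<bar>c (ordering S)\<bar>)"
      unfolding eq using ordering[OF S'(2)] abs_eq
      by (intro sum.cong) (auto dest: permutations_of_setD)
    then show "(\<Sum>vs | vs \<in> ?A \<and> set vs = S. \<bar>c vs\<bar>) = fact (n + 1) * \<bar>c (ordering S)\<bar>"
      using S' by (simp del: fact_Suc)
  qed
  finally show ?thesis by (simp add: l1_norm_def sum_distrib_left del: fact_Suc)
qed

section \<open>Push-forward along a map of vertices\<close>

text \<open>
  The chain map induced by a map \<open>f\<close> of vertices: the coefficient of \<open>ws\<close> is the sum over the lists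
  in \<open>V\<close> that \<open>f\<close> maps to \<open>ws\<close>. No case distinction for degenerate simplices is needed: if \<open>c\<close>
  alternates, then so does the result, which therefore vanishes on lists with repetitions. The set \<open>V\<close> has to contain the
  vertices of \<open>c\<close>; if finite, it makes the sum finite.
\<close>
definition push :: "('a \<Rightarrow> 'b) \<Rightarrow> 'a set \<Rightarrow> ('a list \<Rightarrow> 'f) \<Rightarrow> 'b list \<Rightarrow> 'f :: linordered_idom" where
  "push f V c ws = (\<Sum>us | set us \<subseteq> V \<and> map f us = ws. c us)"

lemma finite_fibre:
  assumes "finite V"
  shows "finite {us. set us \<subseteq> V \<and> map f us = ws}"
proof (rule finite_subset)
  show "{us. set us \<subseteq> V \<and> map f us = ws} \<subseteq> lists_on (length ws) V"
    by (auto simp: lists_on_def)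
  show "finite (lists_on (length ws) V)"
    by (rule finite_lists_on[OF assms])
qed

lemma set_map_subset: "f ` V \<subseteq> W \<Longrightarrow> set us \<subseteq> V \<Longrightarrow> set (map f us) \<subseteq> W"
  by (metis image_mono order_trans set_map)

lemma push_Cons:
  assumes "finite V"
  shows "push f V c (w # ws) = (\<Sum>v | v \<in> V \<and> f v = w. push f V (\<lambda>u. c (v # u)) ws)"
proof -
  let ?A = "{v. v \<in> V \<and> f v = w}" and ?B = "{us. set us \<subseteq> V \<and> map f us = ws}"
  have "push f V c (w # ws) = (\<Sum>(v, us) \<in> ?A \<times> ?B. c (v # us))"
    unfolding push_def
    by (rule sum.reindex_bij_witness[of _ "\<lambda>(v, us). v # us" "\<lambda>u. (hd u, tl u)"]) auto
  then show ?thesis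
    by (simp add: push_def sum.cartesian_product)
qed

lemma push_lincomb: "push f V (\<lambda>u. c u + t * e u) ws = push f V c ws + t * push f V e ws"
  by (simp add: push_def sum.distrib sum_distrib_left)

lemma push_sum: "push f V (\<lambda>u. \<Sum>i\<in>I. c i u) ws = (\<Sum>i\<in>I. push f V (c i) ws)"
  unfolding push_def by (rule sum.swap)

lemma alternating_push:
  assumes V: "finite V" and "alternating c"
  shows "alternating (push f V c)"
proof -
  have "push f V c (xs @ a # b # ys) = - push f V c (xs @ b # a # ys)" for xs a b ys
    using assms(2)
  proof (induction xs arbitrary: c)
    case Nil
    have "push f V c (a # b # ys) = (\<Sum>v | v \<in> V \<and> f v = a. \<Sum>u | u \<in> V \<and> f u = b.
        push f V (\<lambda>t. c (v # u # t)) ys)"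
      by (simp add: push_Cons[OF V])
    also have "\<dots> = (\<Sum>u | u \<in> V \<and> f u = b. \<Sum>v | v \<in> V \<and> f v = a.
        push f V (\<lambda>t. c (v # u # t)) ys)"
      by (rule sum.swap)
    also have "\<dots> = (\<Sum>u | u \<in> V \<and> f u = b. \<Sum>v | v \<in> V \<and> f v = a.
        - push f V (\<lambda>t. c (u # v # t)) ys)"
    proof (intro sum.cong refl)
      fix u v
      show "push f V (\<lambda>t. c (v # u # t)) ys = - push f V (\<lambda>t. c (u # v # t)) ys"
        unfolding push_def sum_negf[symmetric]
        by (rule sum.cong[OF refl alternating_swap_head[OF Nil]])
    qed
    also have "\<dots> = - push f V c (b # a # ys)"
      by (simp add: push_Cons[OF V] sum_negf)
    finally show ?case by simp
  next
    case (Cons x xs)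
    have "push f V (\<lambda>u. c (v # u)) (xs @ a # b # ys) = - push f V (\<lambda>u. c (v # u)) (xs @ b # a # ys)" for v
      by (rule Cons.IH[OF alternating_Cons[OF Cons.prems]])
    then show ?case
      by (simp only: append_Cons push_Cons[OF V] sum_negf)
  qed
  then show ?thesis unfolding alternating_def by blast
qed

lemma push_chains:
  assumes "finite V" "c \<in> chains n V" "f ` V \<subseteq> W"
  shows "push f V c \<in> chains n W"
proof (rule chainsI)
  show "alternating (push f V c)"
    using assms alternating_push chains_alternating by blast
  fix ws assume "push f V c ws \<noteq> 0"
  then obtain us where us: "set us \<subseteq> V" "map f us = ws" "c us \<noteq> 0"
    unfolding push_def by (elim sum.not_neutral_contains_not_neutral) auto
  then have "length us = n + 1" using assms(2) chains_support by blast
  then show "length ws = n + 1 \<and> set ws \<subseteq> W"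
    using us set_map_subset[OF assms(3) us(1)] by auto
qed

lemma boundary_push:
  assumes V: "finite V" and W: "finite W" and c: "c \<in> chains n V" and f: "f ` V \<subseteq> W"
  shows "boundary (push f V c) = push f V (boundary c)"
proof
  fix ws
  have "boundary (push f V c) ws = (\<Sum>w\<in>W. push f V c (w # ws))"
    by (rule boundary_eq[OF push_chains[OF V c f] W])
  also have "\<dots> = (\<Sum>w\<in>W. \<Sum>v | v \<in> V \<and> f v = w. push f V (\<lambda>u. c (v # u)) ws)"
    by (simp add: push_Cons[OF V])
  also have "\<dots> = (\<Sum>v\<in>V. push f V (\<lambda>u. c (v # u)) ws)"
    by (rule sum.group[OF V W f])
  also have "\<dots> = push f V (\<lambda>u. \<Sum>v\<in>V. c (v # u)) ws"
    by (simp add: push_sum)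
  also have "(\<lambda>u. \<Sum>v\<in>V. c (v # u)) = boundary c"
    using boundary_eq[OF c V] by auto
  finally show "boundary (push f V c) ws = push f V (boundary c) ws" .
qed

lemma push_push:
  assumes V: "finite V" and W: "finite W" and f: "f ` V \<subseteq> W"
  shows "push g W (push f V c) = push (g \<circ> f) V c"
proof
  fix ws
  let ?S = "{us. set us \<subseteq> V \<and> map (g \<circ> f) us = ws}"
  let ?T = "{us. set us \<subseteq> W \<and> map g us = ws}"
  have fin: "finite ?S" "finite ?T"
    by (rule finite_fibre[OF V], rule finite_fibre[OF W])
  have "push (g \<circ> f) V c ws = (\<Sum>t\<in>?T. \<Sum>us | us \<in> ?S \<and> map f us = t. c us)"
    unfolding push_def
    by (rule sum.group[symmetric]) (use fin set_map_subset[OF f] in \<open>auto simp del: set_map\<close>)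
  also have "\<dots> = push g W (push f V c) ws"
    unfolding push_def
    by (intro sum.cong refl) auto
  finally show "push g W (push f V c) ws = push (g \<circ> f) V c ws" by simp
qed

lemma push_id:
  assumes c: "c \<in> chains n V" and f: "\<And>v. v \<in> V \<Longrightarrow> f v = v"
  shows "push f V c = c"
proof
  fix ws
  have "{us. set us \<subseteq> V \<and> map f us = ws} = (if set ws \<subseteq> V then {ws} else {})"
    using f by (auto simp: subset_iff map_idI)
  then show "push f V c ws = c ws"
    using chains_support[OF c, of ws] by (auto simp: push_def)
qed

lemma push_simplex_chain:
  fixes f :: "'a \<Rightarrow> 'b"
  assumes V: "finite V" and f: "inj_on f V" and us: "distinct us" "set us \<subseteq> V" "length us = n + 1"
  shows "push f V (simplex_chain (osimplex us)) = (simplex_chain (osimplex (map f us)) :: ('b, 'f :: linordered_idom) chain)"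
proof
  fix ws
  let ?c = "push f V (simplex_chain (osimplex us)) :: ('b, 'f) chain"
  have dist: "distinct (map f us)"
    using us f by (auto simp: distinct_map intro: inj_on_subset)
  have "{t. set t \<subseteq> V \<and> map f t = map f us} = {us}"
    using us f by (auto dest!: map_inj_on intro: inj_on_subset)
  then have one: "?c (map f us) = 1"
    by (simp add: push_def simplex_chain_self)
  have alt: "alternating (simplex_chain (osimplex us) :: ('a, 'f) chain)"
    by (rule chains_alternating[OF simplex_chain_chains[OF us(1,3,2)]])
  have "simplex_chain (osimplex (map f us)) ws = ?c (map f us) * simplex_chain (osimplex (map f us)) ws"
    by (simp add: one)
  also have "\<dots> = (if mset ws = mset (map f us) then ?c ws else 0)"
    by (rule alternating_mult_simplex_chain[OF alternating_push[OF V alt] dist])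
  also have "\<dots> = ?c ws"
  proof -
    have "?c ws = 0" if "mset ws \<noteq> mset (map f us)"
      unfolding push_def
    proof (rule sum.neutral, safe)
      fix t assume "ws = map f t"
      then have "mset t \<noteq> mset us" using that by auto
      then show "simplex_chain (osimplex us) t = 0" using simplex_chain_nonzero by blast
    qed
    then show ?thesis by auto
  qed
  finally show "?c ws = simplex_chain (osimplex (map f us)) ws" by simp
qed

text \<open>
  A push-forward does not increase the \<open>l\<^sub>1\<close> norm, and the simplices on which \<open>f\<close> is not injective
  contribute nothing.
\<close>
lemma sum_abs_push_le:
  assumes V: "finite V" and W: "finite W" and c: "alternating c" and f: "f ` V \<subseteq> W"
  shows "(\<Sum>ws\<in>lists_on n W. \<bar>push f V c ws\<bar>)
      \<le> (\<Sum>us | us \<in> lists_on n V \<and> distinct (map f us). \<bar>c us\<bar>)"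
proof -
  let ?S = "{us. us \<in> lists_on n V \<and> distinct (map f us)}"
  have "(\<Sum>ws\<in>lists_on n W. \<bar>push f V c ws\<bar>)
      \<le> (\<Sum>ws\<in>lists_on n W. \<Sum>us | us \<in> ?S \<and> map f us = ws. \<bar>c us\<bar>)"
  proof (rule sum_mono)
    fix ws assume ws: "ws \<in> lists_on n W"
    show "\<bar>push f V c ws\<bar> \<le> (\<Sum>us | us \<in> ?S \<and> map f us = ws. \<bar>c us\<bar>)"
    proof (cases "distinct ws")
      case True
      then have "{us. us \<in> ?S \<and> map f us = ws} = {us. set us \<subseteq> V \<and> map f us = ws}"
        using ws by (auto simp: lists_on_def)
      then show ?thesis
        by (simp add: push_def sum_abs)
    next
      case False
      then have "push f V c ws = 0"
        by (rule alternating_nondistinct[OF alternating_push[OF V c]])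
      then show ?thesis by (simp add: sum_nonneg)
    qed
  qed
  also have "\<dots> = (\<Sum>us\<in>?S. \<bar>c us\<bar>)"

    by (rule sum.group)
      (use set_map_subset[OF f] finite_lists_on[OF V, of n] finite_lists_on[OF W] in
        \<open>auto simp: lists_on_def simp del: set_map intro: rev_finite_subset\<close>)
  finally show ?thesis by simp
qed

text \<open>
  On \<open>n + 1\<close> vertices there is only one \<open>n\<close>-simplex, and its boundary is not zero.
\<close>
lemma cycle_on_simplex_eq_0:
  assumes c: "c \<in> chains n W" and W: "finite W" "card W = n + 1" and "boundary c = (\<lambda>_. 0)"
  shows "c u = 0"
proof (rule ccontr)
  assume nz: "c u \<noteq> 0"
  then have u: "length u = n + 1" "set u \<subseteq> W" "distinct u"
    using c by (auto simp: chains_def)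
  then obtain v ws where vws: "u = v # ws" by (cases u) auto
  have "set u = W"
    using u W by (intro card_subset_eq) (auto simp: distinct_card)
  have "0 = boundary c ws" by (simp add: assms)
  also have "\<dots> = (\<Sum>w\<in>W. c (w # ws))"
    by (rule boundary_eq[OF c W(1)])
  also have "\<dots> = (\<Sum>w\<in>{v}. c (w # ws))"
  proof (rule sum.mono_neutral_right)
    show "\<forall>w\<in>W - {v}. c (w # ws) = 0"
      using \<open>set u = W\<close> vws by (auto intro!: alternating_nondistinct[OF chains_alternating[OF c]])
  qed (use W u vws in auto)
  finally show False using nz vws by simp
qed

section \<open>Cones\<close>

text \<open>
  The cone over a chain with apex \<open>x\<close>: on a list containing \<open>x\<close> once, it takes the coefficient of
  the remaining list, with the sign for moving \<open>x\<close> to the front. The recursion sums over the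
  positions of \<open>x\<close>, which keeps the cone alternating; simplices of the base that contain \<open>x\<close> then
  contribute nothing.
\<close>
fun cone :: "'a \<Rightarrow> ('a list \<Rightarrow> 'f) \<Rightarrow> 'a list \<Rightarrow> 'f :: linordered_idom" where
  "cone x c [] = 0"
| "cone x c (v # ws) = (if v = x then c ws else 0) - cone x (\<lambda>u. c (v # u)) ws"

lemma cone_uminus: "cone x (\<lambda>u. - c u) ws = - cone x c ws"
  by (induction ws arbitrary: c) auto

lemma cone_sum: "cone x (\<lambda>u. \<Sum>i\<in>I. c i u) ws = (\<Sum>i\<in>I. cone x (c i) ws)"
  by (induction ws arbitrary: c) (auto simp: sum_subtractf)

lemma alternating_cone:
  assumes "alternating c"
  shows "alternating (cone x c)"
proof -
  have "cone x c (xs @ a # b # ys) = - cone x c (xs @ b # a # ys)" for xs a b ys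
    using assms
  proof (induction xs arbitrary: c)
    case Nil
    have "cone x (\<lambda>u. c (a # b # u)) ys = cone x (\<lambda>u. - c (b # a # u)) ys"
      by (subst alternating_swap_head[OF Nil]) (rule refl)
    then show ?case by (simp add: cone_uminus)
  next
    case (Cons v xs)
    have "cone x (\<lambda>u. c (v # u)) (xs @ a # b # ys) = - cone x (\<lambda>u. c (v # u)) (xs @ b # a # ys)"
      by (rule Cons.IH[OF alternating_Cons[OF Cons.prems]])
    moreover have "c (xs @ a # b # ys) = - c (xs @ b # a # ys)"
      by (rule alternatingD[OF Cons.prems])
    ultimately show ?case by simp
  qed
  then show ?thesis unfolding alternating_def by blast
qed

lemma cone_nonzero:
  "cone x c ws \<noteq> 0 \<Longrightarrow> \<exists>us. c us \<noteq> 0 \<and> length ws = length us + 1 \<and> set ws \<subseteq> insert x (set us)"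
proof (induction ws arbitrary: c)
  case (Cons v ws)
  show ?case
  proof (cases "v = x \<and> c ws \<noteq> 0")
    case False
    then have "cone x (\<lambda>u. c (v # u)) ws \<noteq> 0"
      using Cons.prems by (auto split: if_splits)
    from Cons.IH[OF this] obtain us where
      "c (v # us) \<noteq> 0" "length ws = length us + 1" "set ws \<subseteq> insert x (set us)" by blast
    then show ?thesis by (intro exI[of _ "v # us"]) auto
  qed (auto intro!: exI[of _ ws])
qed simp

lemma cone_chains:
  assumes "c \<in> chains n V" "x \<in> V"
  shows "cone x c \<in> chains (n + 1) V"
proof (rule chainsI)
  show "alternating (cone x c)"
    using assms by (intro alternating_cone chains_alternating)
  fix ws assume "cone x c ws \<noteq> 0"
  then obtain us where "c us \<noteq> 0" "length ws = length us + 1" "set ws \<subseteq> insert x (set us)"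
    by (elim cone_nonzero[THEN exE]) blast
  then show "length ws = n + 1 + 1 \<and> set ws \<subseteq> V"
    using chains_support[OF assms(1)] assms(2) by fastforce
qed

lemma boundary_cone:
  assumes c: "c \<in> chains n V" and V: "finite V" and x: "x \<in> V" and "boundary c = (\<lambda>_. 0)"
  shows "boundary (cone x c) = c"
proof
  fix ws
  have "boundary (cone x c) ws = (\<Sum>v\<in>V. cone x c (v # ws))"
    by (rule boundary_eq[OF cone_chains[OF c x] V])
  also have "\<dots> = c ws - cone x (\<lambda>u. \<Sum>v\<in>V. c (v # u)) ws"
    using V x by (simp add: sum_subtractf cone_sum)
  also have "(\<lambda>u. \<Sum>v\<in>V. c (v # u)) = (\<lambda>_. 0)"
    unfolding boundary_eq[OF c V, symmetric] by (simp only: assms(4))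
  also have "cone x (\<lambda>_. 0) ws = (0 :: 'b)"
    using cone_sum[of x "\<lambda>_ _. 0" "{}"] by simp
  finally show "boundary (cone x c) ws = c ws" by simp
qed

section \<open>Attainment of a minimal \<open>l\<^sub>1\<close> norm\<close>

text \<open>
  Over an ordered field that need not be complete, compactness cannot give a minimum of the
  \<open>l\<^sub>1\<close> norm on an affine set. Instead, call a point extreme if its support on \<open>I\<close> contains the
  support of no other point, points being compared on \<open>I\<close>. A point that is not extreme can be moved
  along a line, in the direction in which the norm does not increase, until a coordinate vanishes;
  so an extreme point of at most the same norm exists. Extreme points with the same support agree on
  \<open>I\<close>, so only finitely many values have to be compared.
\<close>
lemma l1_minimum_attained:
  fixes A :: "('i \<Rightarrow> 'f :: linordered_field) set"
  assumes I: "finite I" and "A \<noteq> {}"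
    and line: "\<And>x y t. x \<in> A \<Longrightarrow> y \<in> A \<Longrightarrow> (\<lambda>i. x i + t * (y i - x i)) \<in> A"
  shows "\<exists>x\<in>A. \<forall>y\<in>A. (\<Sum>i\<in>I. \<bar>x i\<bar>) \<le> (\<Sum>i\<in>I. \<bar>y i\<bar>)"
proof -
  define nrm where "nrm x = (\<Sum>i\<in>I. \<bar>x i\<bar>)" for x :: "'i \<Rightarrow> 'f"
  define supp where "supp x = {i \<in> I. x i \<noteq> 0}" for x :: "'i \<Rightarrow> 'f"
  define E where "E = {x \<in> A. \<forall>y\<in>A. supp y \<subseteq> supp x \<longrightarrow> (\<forall>i\<in>I. y i = x i)}"
  have descent: "\<exists>z\<in>A. supp z \<subset> supp x \<and> nrm z \<le> nrm x" if x: "x \<in> A" "x \<notin> E" for x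
  proof -
    obtain y i0 where y: "y \<in> A" "supp y \<subseteq> supp x" "i0 \<in> I" "y i0 \<noteq> x i0"
      using x unfolding E_def by blast
    \<comment> \<open>As long as no coordinate of \<open>x\<close> changes sign, the norm is affine along the line with
      the slope below; \<open>s\<close> picks the direction that makes it nonpositive.\<close>
    define s :: 'f where "s = (if (\<Sum>i\<in>I. sgn (x i) * (y i - x i)) \<le> 0 then 1 else - 1)"
    define g where "g i = s * (y i - x i)" for i
    have "(\<Sum>i\<in>I. sgn (x i) * g i) = s * (\<Sum>i\<in>I. sgn (x i) * (y i - x i))"
      by (simp add: g_def sum_distrib_left ac_simps)
    then have slope: "(\<Sum>i\<in>I. sgn (x i) * g i) \<le> 0"
      by (simp add: s_def)
    have g0: "g i = 0" if "i \<in> I" "x i = 0" for i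
      using that y(2) by (auto simp: g_def supp_def)
    have gi0: "g i0 \<noteq> 0" using y by (simp add: g_def s_def)
    \<comment> \<open>\<open>J\<close> holds the coordinates that move towards zero, and \<open>t\<close> is the first time at which
      one of them gets there.\<close>
    define J where "J = {i \<in> I. x i * g i < 0}"
    have J: "finite J" "J \<subseteq> I" using I by (auto simp: J_def)
    have "J \<noteq> {}"
    proof
      assume "J = {}"
      have "sgn (x i) * g i = \<bar>g i\<bar>" if "i \<in> I" for i
      proof -
        have "0 \<le> x i * g i" using \<open>J = {}\<close> that by (auto simp: J_def not_less)
        then show ?thesis
          using g0[OF that] by (cases "x i" "0 :: 'f" rule: linorder_cases)
            (auto simp: zero_le_mult_iff)
      qed
      then have "(\<Sum>i\<in>I. \<bar>g i\<bar>) \<le> 0" using slope by simp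
      then have "\<bar>g i0\<bar> \<le> 0"
        using member_le_sum[of i0 I "\<lambda>i. \<bar>g i\<bar>"] I y(3) by simp
      then show False using gi0 by simp
    qed
    define t where "t = Min ((\<lambda>i. - x i / g i) ` J)"
    have "t \<in> (\<lambda>i. - x i / g i) ` J"
      unfolding t_def using J \<open>J \<noteq> {}\<close> by (intro Min_in) auto
    then obtain k where k: "k \<in> J" "t = - x k / g k" by blast
    have t_le: "t \<le> - x i / g i" if "i \<in> J" for i
      unfolding t_def using J that by (intro Min_le) auto
    have t_pos: "0 < t"
      using k by (auto simp: J_def mult_less_0_iff divide_pos_neg divide_neg_pos divide_less_0_iff)
    define z where "z i = x i + t * g i" for i
    have "z = (\<lambda>i. x i + (t * s) * (y i - x i))"
      by (simp add: z_def g_def fun_eq_iff)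
    then have zA: "z \<in> A" using line[OF x(1) y(1), of "t * s"] by simp
    have zk: "z k = 0"
      using k by (auto simp: z_def J_def)
    have "supp z \<subseteq> supp x"
      using g0 by (auto simp: supp_def z_def)
    moreover have "k \<in> supp x" "k \<notin> supp z"
      using k zk by (auto simp: supp_def J_def)
    ultimately have "supp z \<subset> supp x" by blast
    moreover have "\<bar>z i\<bar> = \<bar>x i\<bar> + t * (sgn (x i) * g i)" if i: "i \<in> I" for i
    proof (cases "x i" "0 :: 'f" rule: linorder_cases)
      case equal
      then show ?thesis using g0[OF i] by (simp add: z_def)
    next
      case less
      have "z i \<le> 0"
      proof (cases "i \<in> J")
        case True
        then have "0 < g i" using less by (auto simp: J_def mult_less_0_iff)
        then show ?thesis using mult_right_mono[OF t_le[OF True], of "g i"] by (simp add: z_def)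
      next
        case False
        then have "g i \<le> 0" using less i by (auto simp: J_def mult_less_0_iff not_less)
        then have "t * g i \<le> 0" using t_pos by (simp add: mult_nonneg_nonpos)
        then show ?thesis using less by (simp add: z_def)
      qed
      then show ?thesis using less by (simp add: z_def)
    next
      case greater
      have "0 \<le> z i"
      proof (cases "i \<in> J")
        case True
        then have "g i < 0" using greater by (auto simp: J_def mult_less_0_iff)
        then show ?thesis using mult_right_mono_neg[OF t_le[OF True], of "g i"] by (simp add: z_def)
      next
        case False
        then have "0 \<le> g i" using greater i by (auto simp: J_def mult_less_0_iff not_less)
        then have "0 \<le> t * g i" using t_pos by simp
        then show ?thesis using greater by (simp add: z_def)
      qed
      then show ?thesis using greater by (simp add: z_def)
    qed
    then have "nrm z = nrm x + t * (\<Sum>i\<in>I. sgn (x i) * g i)"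
      by (simp add: nrm_def sum.distrib sum_distrib_left)
    then have "nrm z \<le> nrm x"
      using slope t_pos by (simp add: mult_nonneg_nonpos)
    ultimately show ?thesis using zA by blast
  qed
  have reduce: "\<exists>e\<in>E. nrm e \<le> nrm x" if "x \<in> A" for x
    using that
  proof (induction "card (supp x)" arbitrary: x rule: less_induct)
    case less
    show ?case
    proof (cases "x \<in> E")
      case False
      then obtain z where z: "z \<in> A" "supp z \<subset> supp x" "nrm z \<le> nrm x"
        using descent[OF less.prems] by blast
      have "card (supp z) < card (supp x)"
        using z(2) I by (intro psubset_card_mono) (auto simp: supp_def)
      then obtain e where "e \<in> E" "nrm e \<le> nrm z" using less.hyps[OF _ z(1)] by blast
      then show ?thesis using z(3) by (meson order_trans)
    qed auto
  qed
  have same: "nrm x = nrm y" if "x \<in> E" "y \<in> E" "supp x = supp y" for x y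
    using that by (auto simp: E_def nrm_def intro!: sum.cong)
  have "nrm ` E \<subseteq> (\<lambda>S. nrm (SOME x. x \<in> E \<and> supp x = S)) ` Pow I"
  proof safe
    fix x assume x: "x \<in> E"
    let ?y = "SOME y. y \<in> E \<and> supp y = supp x"
    have "?y \<in> E \<and> supp ?y = supp x" by (rule someI[of _ x]) (simp add: x)
    then have "nrm x = nrm ?y" using same x by metis
    moreover have "supp x \<in> Pow I" by (auto simp: supp_def)
    ultimately show "nrm x \<in> (\<lambda>S. nrm (SOME x. x \<in> E \<and> supp x = S)) ` Pow I" by blast
  qed
  then have fin: "finite (nrm ` E)" using I by (simp add: finite_subset)
  have "E \<noteq> {}" using \<open>A \<noteq> {}\<close> reduce by blast
  then have "Min (nrm ` E) \<in> nrm ` E" using fin by (intro Min_in) auto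
  then obtain e where e: "e \<in> E" "nrm e = Min (nrm ` E)" by (metis imageE)
  have "nrm e \<le> nrm y" if y: "y \<in> A" for y
  proof -
    obtain e' where "e' \<in> E" "nrm e' \<le> nrm y" using reduce[OF y] by blast
    then show ?thesis using fin e(2) by (metis Min_le image_eqI order_trans)
  qed
  then show ?thesis using e(1) by (auto simp: E_def nrm_def)
qed

section \<open>Minimal fillings\<close>

lemma boundary_lincomb:
  assumes "finite V" "c \<in> chains n V" "e \<in> chains n V"
  shows "boundary (\<lambda>u. c u + t * e u) ws = boundary c ws + t * boundary e ws"
  unfolding boundary_eq[OF assms(2,1)] boundary_eq[OF assms(3,1)]
    boundary_eq[OF chains_lincomb[OF assms(2,3)] assms(1)]
  by (simp add: sum.distrib sum_distrib_left)

text \<open>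
  An \<open>n\<close>-chain on the vertex set \<open>V\<close> with boundary \<open>z\<close> and the smallest \<open>l\<^sub>1\<close> norm among all of these.
\<close>
definition minimal_filling ::
    "nat \<Rightarrow> 'a set \<Rightarrow> ('a, 'f :: linordered_idom) chain \<Rightarrow> ('a, 'f) chain \<Rightarrow> bool" where
  "minimal_filling n V z \<alpha> \<longleftrightarrow> \<alpha> \<in> chains n V \<and> boundary \<alpha> = z \<and>
     (\<forall>\<beta>\<in>chains n V. boundary \<beta> = z \<longrightarrow> l1_norm \<alpha> \<le> l1_norm \<beta>)"

lemma filling_volume_eq:
  assumes "minimal_filling (d + 1) (vertices K) (complex_chain K) \<alpha>"
  shows "filling_volume d K = l1_norm \<alpha>"
  unfolding filling_volume_def
  using assms by (intro Least_equality) (auto simp: minimal_filling_def)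

lemma minimal_filling_exists:
  fixes z :: "('a, 'f :: linordered_field) chain"
  assumes V: "finite V" "x \<in> V" and z: "z \<in> chains n V" "boundary z = (\<lambda>_. 0)"
  shows "\<exists>\<alpha>. minimal_filling (n + 1) V z \<alpha>"
proof -
  define A where "A = {\<alpha> \<in> chains (n + 1) V. boundary \<alpha> = z}"
  have "\<exists>\<alpha>\<in>A. \<forall>\<beta>\<in>A. (\<Sum>u\<in>lists_on (n + 1 + 1) V. \<bar>\<alpha> u\<bar>) \<le> (\<Sum>u\<in>lists_on (n + 1 + 1) V. \<bar>\<beta> u\<bar>)"
  proof (rule l1_minimum_attained)
    show "finite (lists_on (n + 1 + 1) V)" by (rule finite_lists_on[OF V(1)])
    have "cone x z \<in> A"
      unfolding A_def using cone_chains[OF z(1) V(2)] boundary_cone[OF z(1) V z(2)] by simp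
    then show "A \<noteq> {}" by blast
    fix c e t assume ce: "c \<in> A" "e \<in> A"
    define diff where "diff = (\<lambda>u. e u + (- 1) * c u)"
    have chains: "c \<in> chains (n + 1) V" "e \<in> chains (n + 1) V" using ce by (auto simp: A_def)
    then have diff: "diff \<in> chains (n + 1) V" unfolding diff_def by (intro chains_lincomb)
    have "boundary diff ws = 0" for ws
      unfolding diff_def boundary_lincomb[OF V(1) chains(2,1)] using ce by (simp add: A_def)
    then have "boundary (\<lambda>u. c u + t * diff u) = z"
      using boundary_lincomb[OF V(1) chains(1) diff] ce by (auto simp: A_def fun_eq_iff)
    then have "(\<lambda>u. c u + t * diff u) \<in> A"
      using chains_lincomb[OF chains(1) diff] by (simp add: A_def)
    then show "(\<lambda>u. c u + t * (e u - c u)) \<in> A" by (simp add: diff_def)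
  qed
  then obtain \<alpha> where \<alpha>: "\<alpha> \<in> A"
    "\<And>\<beta>. \<beta> \<in> A \<Longrightarrow> (\<Sum>u\<in>lists_on (n + 1 + 1) V. \<bar>\<alpha> u\<bar>) \<le> (\<Sum>u\<in>lists_on (n + 1 + 1) V. \<bar>\<beta> u\<bar>)"
    by blast
  have "l1_norm \<alpha> \<le> l1_norm \<beta>" if \<beta>: "\<beta> \<in> A" for \<beta>
  proof -
    have "\<alpha> \<in> chains (n + 1) V" "\<beta> \<in> chains (n + 1) V"
      using \<alpha>(1) \<beta> by (auto simp: A_def)
    then have "fact (n + 1 + 1) * l1_norm \<alpha> \<le> fact (n + 1 + 1) * l1_norm \<beta>"
      using \<alpha>(2)[OF \<beta>] V(1) by (simp only: sum_abs_eq_l1_norm)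
    then show ?thesis by (simp only: mult_le_cancel_left_pos[OF fact_gt_zero])
  qed
  then show ?thesis
    using \<alpha>(1) by (auto simp: minimal_filling_def A_def)
qed

section \<open>Gluing two cycles along a simplex\<close>

text \<open>
  The retraction onto \<open>V\<close>, which is embedded by \<open>j\<close>: points outside the image of \<open>V\<close> go to \<open>p\<close>.
\<close>
definition collapse :: "'a set \<Rightarrow> ('a \<Rightarrow> 'c) \<Rightarrow> 'a \<Rightarrow> 'c \<Rightarrow> 'a" where
  "collapse V j p y = (if y \<in> j ` V then inv_into V j y else p)"

lemma collapse_image: "inj_on j V \<Longrightarrow> v \<in> V \<Longrightarrow> collapse V j p (j v) = v"
  by (simp add: collapse_def)

text \<open>
  Collapsing the second side turns a filling of the glued cycle into a filling of the first cycle: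
  the image of \<open>z'\<close> is a cycle supported on the common simplex, hence zero.
\<close>
lemma push_collapse_filling:
  fixes z :: "('a, 'f :: linordered_idom) chain" and z' :: "('b, 'f) chain"
  assumes fin: "finite V" "finite V'" and j: "inj_on j V"
    and S: "S \<subseteq> V" "card S = n + 1" "p \<in> S" and meet: "j ` V \<inter> j' ` V' \<subseteq> j ` S"
    and W: "W = j ` V \<union> j' ` V'"
    and z: "z \<in> chains n V" and z': "z' \<in> chains n V'" "boundary z' = (\<lambda>_. 0)"
    and \<beta>: "\<beta> \<in> chains (n + 1) W" "boundary \<beta> = (\<lambda>u. push j V z u + push j' V' z' u)"
  shows "push (collapse V j p) W \<beta> \<in> chains (n + 1) V"
    "boundary (push (collapse V j p) W \<beta>) = z"
proof -
  let ?r = "collapse V j p"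
  have finW: "finite W" and jW: "j ` V \<subseteq> W" and j'W: "j' ` V' \<subseteq> W" using fin W by auto
  have finS: "finite S" using S(1) fin(1) by (rule finite_subset)
  have rW: "?r ` W \<subseteq> V"
    using S by (auto simp: collapse_def inv_into_into)
  show "push ?r W \<beta> \<in> chains (n + 1) V"
    by (rule push_chains[OF finW \<beta>(1) rW])
  have r': "(?r \<circ> j') ` V' \<subseteq> S"
  proof safe
    fix v assume v: "v \<in> V'"
    show "(?r \<circ> j') v \<in> S"
    proof (cases "j' v \<in> j ` V")
      case True
      then obtain s where "s \<in> S" "j' v = j s" using meet v by blast
      then show ?thesis using j S by (auto simp: collapse_image)
    qed (simp add: collapse_def S)
  qed
  have zero: "push (?r \<circ> j') V' z' u = 0" for u
  proof (rule cycle_on_simplex_eq_0[OF push_chains[OF fin(2) z'(1) r'] finS S(2)])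
    show "boundary (push (?r \<circ> j') V' z') = (\<lambda>_. 0)"
      unfolding boundary_push[OF fin(2) finS z'(1) r'] z'(2) by (auto simp: push_def)
  qed
  have "boundary (push ?r W \<beta>) u = z u" for u
  proof -
    have "boundary (push ?r W \<beta>) u = push ?r W (boundary \<beta>) u"
      by (simp only: boundary_push[OF finW fin(1) \<beta>(1) rW])
    also have "\<dots> = push ?r W (push j V z) u + push ?r W (push j' V' z') u"
      using push_lincomb[of ?r W "push j V z" 1 "push j' V' z'" u] by (simp add: \<beta>(2))
    also have "push ?r W (push j' V' z') u = 0"
      by (simp only: push_push[OF fin(2) finW j'W] zero)
    also have "push ?r W (push j V z) = z"
      unfolding push_push[OF fin(1) finW jW]
      by (rule push_id[OF z]) (simp add: collapse_image[OF j])
    finally show ?thesis by simp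
  qed
  then show "boundary (push ?r W \<beta>) = z" by blast
qed

text \<open>
  The two retractions collapse to \<^emph>\<open>different\<close> vertices of the common simplex, which is where
  \<open>d \<ge> 1\<close> is needed. If both are injective on \<open>T\<close>, then \<open>T\<close> contains at most one point with image
  \<open>vs ! 0\<close> under the first and at most one with image \<open>vs' ! 1\<close> under the second. These points
  include all those outside the common simplex as well as the first two vertices of that simplex, so
  at most \<open>d - 1\<close> further points of \<open>T\<close> are left.
\<close>
lemma collapse_both_not_injective:
  assumes j: "inj_on j V" and j': "inj_on j' V'"
    and vs: "distinct vs" "set vs \<subseteq> V" "length vs = d + 1"
    and vs': "set vs' \<subseteq> V'" "length vs' = d + 1"
    and d: "d \<ge> 1" and eq: "map j vs = map j' vs'"
    and meet: "j ` V \<inter> j' ` V' \<subseteq> j ` set vs"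
    and T: "T \<subseteq> j ` V \<union> j' ` V'" "finite T" "card T = d + 2"
    and inj: "inj_on (collapse V j (vs ! 0)) T" "inj_on (collapse V' j' (vs' ! 1)) T"
  shows False
proof -
  let ?r = "collapse V j (vs ! 0)" and ?r' = "collapse V' j' (vs' ! 1)"
  define B where "B = {y \<in> T. ?r y = vs ! 0}"
  define A where "A = {y \<in> T. ?r' y = vs' ! 1}"
  define C where "C = j ` set vs - {j (vs ! 0), j (vs ! 1)}"
  have B1: "card B \<le> 1"
    using card_inj_on_le[of ?r B "{vs ! 0}"] inj(1) by (auto simp: B_def intro: inj_on_subset)
  have A1: "card A \<le> 1"
    using card_inj_on_le[of ?r' A "{vs' ! 1}"] inj(2) by (auto simp: A_def intro: inj_on_subset)
  have mem: "vs ! 0 \<in> set vs" "vs ! 1 \<in> set vs" "vs' ! 1 \<in> set vs'"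
    using vs(3) vs'(2) d by auto
  have "j (vs ! 0) \<noteq> j (vs ! 1)"
    using j mem vs d by (metis One_nat_def add_gr_0 inj_onD less_add_same_cancel2 less_eq_Suc_le
        nth_eq_iff_index_eq subsetD zero_neq_one)
  then have "card C = card (j ` set vs) - 2"
    unfolding C_def using mem by (subst card_Diff_subset) auto
  also have "card (j ` set vs) = d + 1"
    using vs j by (simp add: card_image inj_on_subset distinct_card)
  finally have C: "card C = d - 1" by simp
  have j1: "j (vs ! 1) = j' (vs' ! 1)"
    using arg_cong[OF eq, of "\<lambda>l. l ! 1"] vs vs' d by simp
  have "T \<subseteq> A \<union> B \<union> C"
  proof
    fix y assume y: "y \<in> T"
    consider "y \<notin> j ` V" | "y \<notin> j' ` V'" | "y \<in> j ` set vs" using meet by blast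
    then show "y \<in> A \<union> B \<union> C"
    proof cases
      case 3
      moreover have "?r (j (vs ! 0)) = vs ! 0"
        by (rule collapse_image[OF j subsetD[OF vs(2) mem(1)]])
      moreover have "?r' (j (vs ! 1)) = vs' ! 1"
        unfolding j1 by (rule collapse_image[OF j' subsetD[OF vs'(1) mem(3)]])
      ultimately show ?thesis using y by (auto simp: A_def B_def C_def)
    qed (use y in \<open>auto simp: A_def B_def collapse_def\<close>)
  qed
  then have "card T \<le> card (A \<union> B \<union> C)"
    using T(2) by (intro card_mono) (auto simp: A_def B_def C_def)
  also have "\<dots> \<le> card A + card B + card C"
    by (meson add_le_mono1 card_Un_le order_trans)
  finally show False using T(3) A1 B1 C d by simp
qed

text \<open>
  The statement of additivity for cycles, with the two vertex sets embedded in a common one by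
  \<open>j\<close> and \<open>j'\<close> and meeting at most in the \<open>d\<close>-simplex \<open>map j vs\<close>.
\<close>
lemma minimal_filling_glue:
  fixes z :: "('a, 'f :: linordered_idom) chain" and z' :: "('b, 'f) chain"
    and j :: "'a \<Rightarrow> 'c" and j' :: "'b \<Rightarrow> 'c"
  assumes fin: "finite V" "finite V'" and j: "inj_on j V" and j': "inj_on j' V'"
    and vs: "distinct vs" "set vs \<subseteq> V" "length vs = d + 1"
    and vs': "distinct vs'" "set vs' \<subseteq> V'" "length vs' = d + 1"
    and d: "d \<ge> 1" and eq: "map j vs = map j' vs'"
    and meet: "j ` V \<inter> j' ` V' \<subseteq> j ` set vs"
    and z: "z \<in> chains d V" "boundary z = (\<lambda>_. 0)"
    and z': "z' \<in> chains d V'" "boundary z' = (\<lambda>_. 0)"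
    and \<alpha>: "minimal_filling (d + 1) V z \<alpha>" and \<alpha>': "minimal_filling (d + 1) V' z' \<alpha>'"
  defines "\<gamma> \<equiv> \<lambda>u. push j V \<alpha> u + push j' V' \<alpha>' u"
  shows "minimal_filling (d + 1) (j ` V \<union> j' ` V') (\<lambda>u. push j V z u + push j' V' z' u) \<gamma>"
    and "l1_norm \<gamma> = l1_norm \<alpha> + l1_norm \<alpha>'"
proof -
  define W where "W = j ` V \<union> j' ` V'"
  have finW: "finite W" and jW: "j ` V \<subseteq> W" and j'W: "j' ` V' \<subseteq> W" using fin by (auto simp: W_def)
  have a: "\<alpha> \<in> chains (d + 1) V" "boundary \<alpha> = z" using \<alpha> by (auto simp: minimal_filling_def)
  have a': "\<alpha>' \<in> chains (d + 1) V'" "boundary \<alpha>' = z'" using \<alpha>' by (auto simp: minimal_filling_def)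
  let ?N = "\<lambda>U (c :: _ \<Rightarrow> 'f). \<Sum>us\<in>lists_on (d + 1 + 1) U. \<bar>c us\<bar>"
  have push_a: "push j V \<alpha> \<in> chains (d + 1) W" by (rule push_chains[OF fin(1) a(1) jW])
  have push_a': "push j' V' \<alpha>' \<in> chains (d + 1) W" by (rule push_chains[OF fin(2) a'(1) j'W])
  have \<gamma>: "\<gamma> = (\<lambda>u. push j V \<alpha> u + 1 * push j' V' \<alpha>' u)" by (simp add: \<gamma>_def)
  have \<gamma>_chain: "\<gamma> \<in> chains (d + 1) W"
    unfolding \<gamma> by (rule chains_lincomb[OF push_a push_a'])
  have "boundary \<gamma> u = push j V z u + push j' V' z' u" for u
    unfolding \<gamma> boundary_lincomb[OF finW push_a push_a'] boundary_push[OF fin(1) finW a(1) jW]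
      boundary_push[OF fin(2) finW a'(1) j'W] a(2) a'(2) by simp
  then have \<gamma>_boundary: "boundary \<gamma> = (\<lambda>u. push j V z u + push j' V' z' u)" by blast
  have "fact (d + 1 + 1) * l1_norm \<gamma> \<le> fact (d + 1 + 1) * (l1_norm \<alpha> + l1_norm \<alpha>')"
  proof -
    have "?N W \<gamma> \<le> ?N W (push j V \<alpha>) + ?N W (push j' V' \<alpha>')"
      unfolding \<gamma>_def sum.distrib[symmetric] by (intro sum_mono abs_triangle_ineq)
    moreover have "?N W (push j V \<alpha>) \<le> ?N V \<alpha>"
      by (rule order_trans[OF sum_abs_push_le[OF fin(1) finW chains_alternating[OF a(1)] jW]])
        (auto intro!: sum_mono2 finite_lists_on fin)
    moreover have "?N W (push j' V' \<alpha>') \<le> ?N V' \<alpha>'"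
      by (rule order_trans[OF sum_abs_push_le[OF fin(2) finW chains_alternating[OF a'(1)] j'W]])
        (auto intro!: sum_mono2 finite_lists_on fin)
    ultimately have "?N W \<gamma> \<le> ?N V \<alpha> + ?N V' \<alpha>'" by linarith
    then show ?thesis
      by (simp only: sum_abs_eq_l1_norm[OF \<gamma>_chain finW] sum_abs_eq_l1_norm[OF a(1) fin(1)]
          sum_abs_eq_l1_norm[OF a'(1) fin(2)] distrib_left)
  qed
  then have upper: "l1_norm \<gamma> \<le> l1_norm \<alpha> + l1_norm \<alpha>'"
    by (simp only: mult_le_cancel_left_pos[OF fact_gt_zero])
  have lower: "l1_norm \<alpha> + l1_norm \<alpha>' \<le> l1_norm \<beta>"
    if \<beta>: "\<beta> \<in> chains (d + 1) W" "boundary \<beta> = (\<lambda>u. push j V z u + push j' V' z' u)" for \<beta>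
  proof -
    let ?r = "collapse V j (vs ! 0)" and ?r' = "collapse V' j' (vs' ! 1)"
    have imgs: "j ` set vs = j' ` set vs'"
      using eq by (metis set_map)
    have cards: "card (set vs) = d + 1" "card (set vs') = d + 1"
      using vs vs' by (auto simp: distinct_card)
    have mem: "vs ! 0 \<in> set vs" "vs' ! 1 \<in> set vs'" using vs vs' d by auto
    have r: "push ?r W \<beta> \<in> chains (d + 1) V" "boundary (push ?r W \<beta>) = z"
      using push_collapse_filling[OF fin j vs(2) cards(1) mem(1) meet W_def z(1) z' \<beta>] by auto
    have meet': "j' ` V' \<inter> j ` V \<subseteq> j' ` set vs'" using meet imgs by auto
    have W': "W = j' ` V' \<union> j ` V" by (auto simp: W_def)
    have \<beta>': "boundary \<beta> = (\<lambda>u. push j' V' z' u + push j V z u)" by (simp add: \<beta>(2) add.commute)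
    have r': "push ?r' W \<beta> \<in> chains (d + 1) V'" "boundary (push ?r' W \<beta>) = z'"
      using push_collapse_filling[OF fin(2,1) j' vs'(2) cards(2) mem(2) meet' W' z'(1) z \<beta>(1) \<beta>']
      by auto
    have rW: "?r ` W \<subseteq> V" using mem vs by (auto simp: collapse_def inv_into_into)
    have r'W: "?r' ` W \<subseteq> V'" using mem vs' by (auto simp: collapse_def inv_into_into)
    have le: "l1_norm \<alpha> \<le> l1_norm (push ?r W \<beta>)" "l1_norm \<alpha>' \<le> l1_norm (push ?r' W \<beta>)"
      using \<alpha> \<alpha>' r r' by (auto simp: minimal_filling_def)
    let ?L = "lists_on (d + 1 + 1) W"
    have finL: "finite ?L" by (rule finite_lists_on[OF finW])
    \<comment> \<open>At most one of the two retractions keeps a given simplex nondegenerate.\<close>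
    have pointwise: "(if distinct (map ?r us) then \<bar>\<beta> us\<bar> else 0)
        + (if distinct (map ?r' us) then \<bar>\<beta> us\<bar> else 0) \<le> \<bar>\<beta> us\<bar>" if us: "us \<in> ?L" for us
    proof (cases "distinct us")
      case True
      have "\<not> (distinct (map ?r us) \<and> distinct (map ?r' us))"
      proof
        assume "distinct (map ?r us) \<and> distinct (map ?r' us)"
        then have inj: "inj_on ?r (set us)" "inj_on ?r' (set us)" by (auto simp: distinct_map)
        have T: "set us \<subseteq> j ` V \<union> j' ` V'" "finite (set us)" "card (set us) = d + 2"
          using us True by (auto simp: lists_on_def W_def distinct_card)
        show False
          by (rule collapse_both_not_injective[OF j j' vs vs'(2,3) d eq meet T inj])
      qed
      then show ?thesis by auto
    next
      case False
      then show ?thesis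
        by (simp add: alternating_nondistinct[OF chains_alternating[OF \<beta>(1)]])
    qed
    have "?N V (push ?r W \<beta>) + ?N V' (push ?r' W \<beta>)
        \<le> (\<Sum>us | us \<in> ?L \<and> distinct (map ?r us). \<bar>\<beta> us\<bar>)
          + (\<Sum>us | us \<in> ?L \<and> distinct (map ?r' us). \<bar>\<beta> us\<bar>)"
      by (intro add_mono sum_abs_push_le finW fin chains_alternating[OF \<beta>(1)] rW r'W)
    also have "\<dots> = (\<Sum>us\<in>?L. (if distinct (map ?r us) then \<bar>\<beta> us\<bar> else 0)
        + (if distinct (map ?r' us) then \<bar>\<beta> us\<bar> else 0))"
      by (simp only: sum.distrib sum.inter_filter[OF finL])
    also have "\<dots> \<le> ?N W \<beta>"
      by (rule sum_mono[OF pointwise])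
    finally have "fact (d + 1 + 1) * (l1_norm (push ?r W \<beta>) + l1_norm (push ?r' W \<beta>))
        \<le> fact (d + 1 + 1) * l1_norm \<beta>"
      by (simp only: sum_abs_eq_l1_norm[OF \<beta>(1) finW] sum_abs_eq_l1_norm[OF r(1) fin(1)]
          sum_abs_eq_l1_norm[OF r'(1) fin(2)] distrib_left)
    then have "l1_norm (push ?r W \<beta>) + l1_norm (push ?r' W \<beta>) \<le> l1_norm \<beta>"
      by (simp only: mult_le_cancel_left_pos[OF fact_gt_zero])
    then show ?thesis using le by linarith
  qed
  show "l1_norm \<gamma> = l1_norm \<alpha> + l1_norm \<alpha>'"
    using upper lower[OF \<gamma>_chain \<gamma>_boundary] by (rule antisym)
  then show "minimal_filling (d + 1) (j ` V \<union> j' ` V') (\<lambda>u. push j V z u + push j' V' z' u) \<gamma>"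
    using \<gamma>_chain \<gamma>_boundary lower by (auto simp: minimal_filling_def W_def[symmetric])
qed

section \<open>Admissible complexes\<close>

lemma admissible_facet:
  assumes "admissible d K" "F \<in> oriented_facets K"
  obtains vs where "distinct vs" "length vs = d + 1" "set vs \<in> simplices K"
    "set vs \<subseteq> vertices K" "F = osimplex vs"
proof -
  have "\<forall>F\<in>oriented_facets K. \<exists>vs. distinct vs \<and> length vs = d + 1 \<and>
      set vs \<in> simplices K \<and> F = osimplex vs"
    using assms(1) by (simp add: admissible_def)
  then obtain vs where vs: "distinct vs" "length vs = d + 1" "set vs \<in> simplices K" "F = osimplex vs"
    using assms(2) by blast
  moreover have "set vs \<subseteq> vertices K" unfolding vertices_def by (rule Union_upper[OF vs(3)])
  ultimately show ?thesis using that by blast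
qed

lemma finite_vertices: "admissible d K \<Longrightarrow> finite (vertices K)"
  by (auto simp: admissible_def simplicial_complex_def vertices_def)

lemma finite_oriented_facets:
  assumes "admissible d K"
  shows "finite (oriented_facets K)"
proof (rule finite_subset)
  show "oriented_facets K \<subseteq> osimplex ` lists_on (d + 1) (vertices K)"
  proof
    fix F assume "F \<in> oriented_facets K"
    then obtain vs where "length vs = d + 1" "set vs \<subseteq> vertices K" "F = osimplex vs"
      by (rule admissible_facet[OF assms])
    then show "F \<in> osimplex ` lists_on (d + 1) (vertices K)"
      unfolding lists_on_def by blast
  qed
  show "finite (osimplex ` lists_on (d + 1) (vertices K))"
    by (intro finite_imageI finite_lists_on finite_vertices[OF assms])
qed

lemma simplex_chain_facet_chains:
  assumes "admissible d K" "F \<in> oriented_facets K"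
  shows "simplex_chain F \<in> chains d (vertices K)"
  using admissible_facet[OF assms] simplex_chain_chains by metis

lemma complex_chain_chains:
  assumes "admissible d K"
  shows "complex_chain K \<in> chains d (vertices K)"
  unfolding complex_chain_def
  by (rule chains_sum) (rule simplex_chain_facet_chains[OF assms])

lemma boundary_complex_chain:
  assumes K: "admissible d K"
  shows "boundary (complex_chain K :: ('a, 'f :: linordered_idom) chain) = (\<lambda>_. 0)"
proof
  fix ws
  let ?V = "vertices K"
  note V = finite_vertices[OF K]
  have "boundary (complex_chain K :: ('a, 'f) chain) ws
      = (\<Sum>v\<in>?V. \<Sum>F\<in>oriented_facets K. simplex_chain F (v # ws))"
    by (simp add: boundary_eq[OF complex_chain_chains[OF K] V]) (simp add: complex_chain_def)
  \<comment> \<open>Admissibility speaks of integral chains, and the coefficients of \<open>simplex_chain F\<close> are integers.\<close>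
  also have "\<dots> = (\<Sum>v\<in>?V. \<Sum>F\<in>oriented_facets K. of_int (simplex_chain F (v # ws)))"
    by (intro sum.cong refl) (simp add: simplex_chain_def)
  also have "\<dots> = of_int (\<Sum>v\<in>?V. \<Sum>F\<in>oriented_facets K. simplex_chain F (v # ws))"
    by simp
  also have "(\<Sum>v\<in>?V. \<Sum>F\<in>oriented_facets K. simplex_chain F (v # ws) :: int)
      = (\<Sum>F\<in>oriented_facets K. \<Sum>v\<in>?V. simplex_chain F (v # ws))"
    by (rule sum.swap)
  also have "\<dots> = (\<Sum>F\<in>oriented_facets K. boundary (simplex_chain F) ws)"
    by (intro sum.cong refl)
      (rule boundary_eq[OF simplex_chain_facet_chains[OF K] V, symmetric])
  also have "\<dots> = 0"
    using K by (simp add: admissible_def)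
  finally show "boundary (complex_chain K :: ('a, 'f) chain) ws = 0" by simp
qed

section \<open>The connected sum\<close>

lemma zip_left_unique:
  assumes "distinct xs" "(a, b) \<in> set (zip xs ys)" "(a, c) \<in> set (zip xs ys)"
  shows "b = c"
  using assms by (auto simp: in_set_zip nth_eq_iff_index_eq)

lemma zip_right_unique:
  assumes "distinct ys" "(a, c) \<in> set (zip xs ys)" "(b, c) \<in> set (zip xs ys)"
  shows "a = b"
  using assms by (auto simp: in_set_zip nth_eq_iff_index_eq)

text \<open>
  Since both lists are distinct, each vertex is identified with at most one other, so the classes
  have at most two elements.
\<close>
lemma glue_relation:
  fixes vs :: "'a list" and vs' :: "'b list"
  assumes "distinct vs" "distinct vs'"
  defines "R \<equiv> {(Inl v :: 'a + 'b, Inr v' :: 'a + 'b) | v v'. (v, v') \<in> set (zip vs vs')}"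
  shows "(R \<union> R\<inverse>)\<^sup>* = Id \<union> R \<union> R\<inverse>"
proof
  show "(R \<union> R\<inverse>)\<^sup>* \<subseteq> Id \<union> R \<union> R\<inverse>"
  proof (rule subrelI)
    fix x y assume "(x, y) \<in> (R \<union> R\<inverse>)\<^sup>*"
    then show "(x, y) \<in> Id \<union> R \<union> R\<inverse>"
    proof (induction rule: rtrancl_induct)
      case (step y z)
      then show ?case
        unfolding R_def
        by (auto dest: zip_left_unique[OF assms(1)] zip_right_unique[OF assms(2)])
    qed simp
  qed
qed auto

lemma glue_eq_iff:
  fixes vs :: "'a list" and vs' :: "'b list"
  assumes "distinct vs" "distinct vs'"
  shows "glue vs vs' (Inl a) = glue vs vs' (Inl a') \<longleftrightarrow> a = a'"
    and "glue vs vs' (Inr b) = glue vs vs' (Inr b') \<longleftrightarrow> b = b'"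
    and "glue vs vs' (Inl a) = glue vs vs' (Inr b) \<longleftrightarrow> (a, b) \<in> set (zip vs vs')"
proof -
  define R where "R = {(Inl v :: 'a + 'b, Inr v' :: 'a + 'b) | v v'. (v, v') \<in> set (zip vs vs')}"
  have star: "(R \<union> R\<inverse>)\<^sup>* = Id \<union> R \<union> R\<inverse>"
    unfolding R_def by (rule glue_relation[OF assms])
  have "equiv UNIV ((R \<union> R\<inverse>)\<^sup>*)"
    by (intro equivI refl_rtrancl sym_rtrancl trans_rtrancl sym_Un_converse) auto
  moreover have "glue vs vs' x = (R \<union> R\<inverse>)\<^sup>* `` {x}" for x
    by (simp only: glue_def R_def Let_def)
  ultimately have "glue vs vs' x = glue vs vs' y \<longleftrightarrow> (x, y) \<in> (R \<union> R\<inverse>)\<^sup>*" for x y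
    by (simp only: eq_equiv_class_iff UNIV_I)
  then have eq: "glue vs vs' x = glue vs vs' y \<longleftrightarrow> (x, y) \<in> Id \<union> R \<union> R\<inverse>" for x y
    by (simp only: star)
  show "glue vs vs' (Inl a) = glue vs vs' (Inl a') \<longleftrightarrow> a = a'"
    "glue vs vs' (Inr b) = glue vs vs' (Inr b') \<longleftrightarrow> b = b'"
    "glue vs vs' (Inl a) = glue vs vs' (Inr b) \<longleftrightarrow> (a, b) \<in> set (zip vs vs')"
    unfolding eq by (auto simp: R_def)
qed

lemma inj_on_glue:
  assumes "distinct vs" "distinct vs'"
  shows "inj_on (glue vs vs' \<circ> Inl) A" "inj_on (glue vs vs' \<circ> Inr) B"
  by (auto simp: inj_on_def glue_eq_iff[OF assms])

lemma map_glue_eq: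
  assumes "distinct vs" "distinct vs'" "length vs = length vs'"
  shows "map (glue vs vs' \<circ> Inl) vs = map (glue vs vs' \<circ> Inr) vs'"
  using assms(3) by (intro nth_equalityI) (auto simp: glue_eq_iff[OF assms(1,2)] in_set_zip)

lemma map_osimp_osimplex: "map_osimp f (osimplex us) = osimplex (map f us)"
proof -
  have "map_osimp f (osimplex us) = {map f (permute_list p us) | p. p permutes {..<length us} \<and> evenperm p}"
    by (auto simp: map_osimp_def osimplex_def)
  also have "\<dots> = osimplex (map f us)"
    unfolding osimplex_def length_map by (intro Collect_cong) (metis permute_list_map)
  finally show ?thesis .
qed

lemma map_osimp_compose: "map_osimp g (map_osimp f F) = map_osimp (g \<circ> f) F"
  by (simp add: map_osimp_def image_image comp_def)

text \<open>
  The hypothesis that \<open>opposite (osimplex vs)\<close> is itself an oriented simplex cannot be dropped, since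
  for a single vertex it is the empty set.
\<close>
lemma simplex_chain_opposite:
  assumes vs: "distinct vs" and us: "distinct us" "opposite (osimplex vs) = osimplex us"
    "length us = n + 1"
  shows "simplex_chain (opposite (osimplex vs)) ws
      = - (simplex_chain (osimplex vs) ws :: 'f :: linordered_idom)"
proof -
  let ?e = "simplex_chain (osimplex vs) :: ('a, 'f) chain"
  have "us \<in> opposite (osimplex vs)" using us(2) osimplex_refl by simp
  then have m: "mset us = mset vs" by (rule mset_opposite)
  then obtain p where p: "p permutes {..<length vs}" "us = permute_list p vs"
    by (metis mset_eq_permutation)
  then have "\<not> evenperm p"
    using \<open>us \<in> opposite (osimplex vs)\<close> permute_list_in_opposite[OF vs p(1)] by simp
  then have us_coeff: "?e us = - 1"
    using p vs by (simp add: simplex_chain_permute sign_def)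
  have len: "length vs = n + 1" using m us(3) by (metis mset_eq_length)
  have "?e us * simplex_chain (osimplex us) ws = (if mset ws = mset us then ?e ws else 0)"
    by (rule alternating_mult_simplex_chain[OF chains_alternating us(1)])
      (rule simplex_chain_chains[OF vs len subset_UNIV])
  also have "\<dots> = ?e ws"
    using simplex_chain_nonzero[of vs ws] m by (cases "?e ws = 0") auto
  finally show ?thesis
    by (simp add: us_coeff us(2))
qed

lemma facet_lists:
  assumes "admissible d K" "G \<in> oriented_facets K" "us \<in> G"
  shows "length us = d + 1" "set us \<subseteq> vertices K"
proof -
  obtain vs where "length vs = d + 1" "set vs \<subseteq> vertices K" "G = osimplex vs"
    using admissible_facet[OF assms(1,2)] by metis
  then show "length us = d + 1" "set us \<subseteq> vertices K"
    using mset_osimplex[of us vs] assms(3) by (metis mset_eq_length, metis mset_eq_setD)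
qed

lemma facet_nonempty: "admissible d K \<Longrightarrow> G \<in> oriented_facets K \<Longrightarrow> G \<noteq> {}"
  using osimplex_refl by (metis admissible_facet empty_iff)

lemma inj_on_map_osimp:
  assumes K: "admissible d K" and f: "inj_on f (vertices K)"
  shows "inj_on (map_osimp f) (oriented_facets K)"
proof (rule inj_onI)
  fix G H assume GH: "G \<in> oriented_facets K" "H \<in> oriented_facets K" "map_osimp f G = map_osimp f H"
  have "inj_on (map f) (lists (vertices K))"
    using f by (rule inj_on_mapI[OF inj_on_subset]) auto
  moreover have "G \<subseteq> lists (vertices K)" "H \<subseteq> lists (vertices K)"
    using GH facet_lists(2)[OF K] by (auto simp: lists_eq_set)
  ultimately show "G = H"
    using GH(3) by (simp add: map_osimp_def inj_on_image_eq_iff)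
qed

lemma facet_unique:
  assumes K: "admissible d K" and "G \<in> oriented_facets K" "H \<in> oriented_facets K"
    and "us \<in> G" "ws \<in> H" "set us = set ws"
  shows "G = H"
proof -
  obtain vs where vs: "distinct vs" "length vs = d + 1" "set vs \<in> simplices K" "G = osimplex vs"
    using admissible_facet[OF K assms(2)] by metis
  have "set us = set vs" using vs(4) assms(4) mset_osimplex mset_eq_setD by metis
  then have "set us \<in> simplices K" "card (set us) = d + 1"
    using vs by (auto simp: distinct_card)
  then have "\<exists>!F. F \<in> oriented_facets K \<and> (\<exists>vs\<in>F. set vs = set us)"
    using K by (simp add: admissible_def)
  then show ?thesis using assms by metis
qed

lemma push_facet:
  assumes K: "admissible d K" and f: "inj_on f (vertices K)" and G: "G \<in> oriented_facets K"
  shows "push f (vertices K) (simplex_chain G) = simplex_chain (map_osimp f G)"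
proof -
  obtain us where us: "distinct us" "length us = d + 1" "set us \<subseteq> vertices K" "G = osimplex us"
    using admissible_facet[OF K G] by metis
  show ?thesis
    unfolding us(4) map_osimp_osimplex
    by (rule push_simplex_chain[OF finite_vertices[OF K] f us(1,3,2)])
qed

lemma sum_map_osimp_remove:
  assumes K: "admissible d K" and f: "inj_on f (vertices K)" and F: "F \<in> oriented_facets K"
  shows "(\<Sum>G\<in>map_osimp f ` (oriented_facets K - {F}). simplex_chain G u)
      = push f (vertices K) (complex_chain K) u - simplex_chain (map_osimp f F) u"
proof -
  have "(\<Sum>G\<in>map_osimp f ` (oriented_facets K - {F}). simplex_chain G u)
      = (\<Sum>G\<in>oriented_facets K - {F}. simplex_chain (map_osimp f G) u)"
    using inj_on_map_osimp[OF K f] by (subst sum.reindex) (auto intro: inj_on_subset)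
  also have "\<dots> = (\<Sum>G\<in>oriented_facets K. simplex_chain (map_osimp f G) u)
      - simplex_chain (map_osimp f F) u"
    using finite_oriented_facets[OF K] F by (simp add: sum_diff1)
  also have "(\<Sum>G\<in>oriented_facets K. simplex_chain (map_osimp f G) u)
      = push f (vertices K) (complex_chain K) u"
    unfolding complex_chain_def push_sum by (intro sum.cong refl) (simp add: push_facet[OF K f])
  finally show ?thesis .
qed

lemma singleton_simplex:
  assumes "admissible d K" "v \<in> vertices K"
  shows "{v} \<in> simplices K"
proof -
  obtain S where S: "S \<in> simplices K" "v \<in> S"
    using assms(2) unfolding vertices_def by (rule UnionE)
  have "simplicial_complex (simplices K)"
    using assms(1) by (simp add: admissible_def)
  then have "\<forall>T. T \<subseteq> S \<and> T \<noteq> {} \<longrightarrow> T \<in> simplices K"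
    using S(1) unfolding simplicial_complex_def by blast
  then show ?thesis using S(2) by simp
qed

text \<open>
  For \<open>d \<ge> 1\<close> the removed simplex is not a vertex, so its removal does not affect the vertex set.
\<close>
lemma vertices_connected_sum:
  assumes d: "d \<ge> 1" and K: "admissible d K" and K': "admissible d K'"
    and vs: "distinct vs" "length vs = d + 1" and vs': "distinct vs'"
  shows "vertices (connected_sum K vs K' vs')
      = (glue vs vs' \<circ> Inl) ` vertices K \<union> (glue vs vs' \<circ> Inr) ` vertices K'"
proof -
  let ?q = "glue vs vs'"
  let ?D = "simplices (connected_sum K vs K' vs')"
  have D: "?D = ((\<lambda>S. (?q \<circ> Inl) ` S) ` simplices K \<union> (\<lambda>S. (?q \<circ> Inr) ` S) ` simplices K')
      - {(?q \<circ> Inl) ` set vs}"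
    by (simp add: connected_sum_def disjoint_union_def Let_def image_Un image_image comp_def)
  have "inj_on (?q \<circ> Inl) (set vs)"
    by (rule inj_on_glue(1)[OF vs(1) vs'])
  then have "card ((?q \<circ> Inl) ` set vs) = card (set vs)"
    by (rule card_image)
  then have "card ((?q \<circ> Inl) ` set vs) = d + 1"
    using vs by (simp add: distinct_card del: image_comp)
  then have ne: "{x} \<noteq> (?q \<circ> Inl) ` set vs" for x
    using d by (metis One_nat_def Suc_eq_plus1 card.empty card.insert empty_iff finite.emptyI
        nat.inject not_one_le_zero)
  have "(?q \<circ> Inl) v \<in> \<Union> ?D" if "v \<in> vertices K" for v
  proof -
    have "(?q \<circ> Inl) ` {v} \<in> ?D"
      unfolding D using singleton_simplex[OF K that] ne[of "(?q \<circ> Inl) v"] by blast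
    then show ?thesis by blast
  qed
  moreover have "(?q \<circ> Inr) v \<in> \<Union> ?D" if "v \<in> vertices K'" for v
  proof -
    have "(?q \<circ> Inr) ` {v} \<in> ?D"
      unfolding D using singleton_simplex[OF K' that] ne[of "(?q \<circ> Inr) v"] by blast
    then show ?thesis by blast
  qed
  moreover have "\<Union> ?D \<subseteq> (?q \<circ> Inl) ` vertices K \<union> (?q \<circ> Inr) ` vertices K'"
    unfolding D vertices_def by blast
  ultimately show ?thesis
    unfolding vertices_def[of "connected_sum K vs K' vs'"] by blast
qed

lemma oriented_facets_connected_sum:
  fixes K :: "'a ocomplex" and K' :: "'b ocomplex"
  assumes K: "admissible d K" and K': "admissible d K'"
    and F: "osimplex vs \<in> oriented_facets K" and F': "opposite (osimplex vs') \<in> oriented_facets K'"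
  shows "oriented_facets (connected_sum K vs K' vs')
      = map_osimp (glue vs vs' \<circ> Inl) ` (oriented_facets K - {osimplex vs})
        \<union> map_osimp (glue vs vs' \<circ> Inr) ` (oriented_facets K' - {opposite (osimplex vs')})"
proof -
  let ?F = "osimplex vs" and ?F' = "opposite (osimplex vs')"
  have mixed: "map_osimp Inl G \<noteq> (map_osimp Inr G' :: ('a + 'b) osimp)"
    if G: "G \<in> oriented_facets K" and G': "G' \<in> oriented_facets K'" for G G'
  proof
    assume eq: "map_osimp Inl G = (map_osimp Inr G' :: ('a + 'b) osimp)"
    obtain us where us: "us \<in> G" using facet_nonempty[OF K G] by blast
    then have "map Inl us \<in> (map_osimp Inl G :: ('a + 'b) osimp)"
      unfolding map_osimp_def by (rule imageI)
    then have "map Inl us \<in> map_osimp Inr G'"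
      by (simp only: eq)
    then obtain ws where "map Inl us = (map Inr ws :: ('a + 'b) list)" by (auto simp: map_osimp_def)
    moreover have "us \<noteq> []" using facet_lists(1)[OF K G us] by auto
    ultimately show False by (cases us; cases ws) auto
  qed
  have inl: "map_osimp Inl ` oriented_facets K - {map_osimp Inl ?F :: ('a + 'b) osimp}
      = map_osimp Inl ` (oriented_facets K - {?F})"
    using inj_on_image_set_diff[OF inj_on_map_osimp[OF K, of Inl], of "oriented_facets K" "{?F}"] F
    by auto
  have inr: "map_osimp Inr ` oriented_facets K' - {map_osimp Inr ?F' :: ('a + 'b) osimp}
      = map_osimp Inr ` (oriented_facets K' - {?F'})"
    using inj_on_image_set_diff[OF inj_on_map_osimp[OF K', of Inr], of "oriented_facets K'" "{?F'}"] F'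
    by auto
  have "map_osimp Inl ` oriented_facets K \<union> map_osimp Inr ` oriented_facets K'
        - {map_osimp Inl ?F, map_osimp Inr ?F'}
      = (map_osimp Inl ` oriented_facets K - {map_osimp Inl ?F})
        \<union> (map_osimp Inr ` oriented_facets K' - {map_osimp Inr ?F'})"
    using mixed[OF _ F'] mixed[OF F] by blast
  then show ?thesis
    unfolding inl inr
    by (simp add: connected_sum_def disjoint_union_def Let_def image_Un image_image map_osimp_compose)
qed

text \<open>
  The two removed facets become opposite orientations of the same simplex, so they cancel in the sum
  of the two cycles. No other facets are identified, because the common simplex carries only one
  facet on each side.
\<close>
lemma complex_chain_connected_sum:
  assumes K: "admissible d K" and K': "admissible d K'"
    and F: "osimplex vs \<in> oriented_facets K" and F': "opposite (osimplex vs') \<in> oriented_facets K'"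
    and vs: "distinct vs" "length vs = d + 1" and vs': "distinct vs'" "length vs' = d + 1"
  defines "j \<equiv> glue vs vs' \<circ> Inl" and "j' \<equiv> glue vs vs' \<circ> Inr"
  shows "complex_chain (connected_sum K vs K' vs')
    = (\<lambda>u. push j (vertices K) (complex_chain K) u
        + push j' (vertices K') (complex_chain K') u :: 'f :: linordered_idom)"
proof
  fix u
  let ?F = "osimplex vs" and ?F' = "opposite (osimplex vs')"
  let ?A = "map_osimp j ` (oriented_facets K - {?F})"
  let ?B = "map_osimp j' ` (oriented_facets K' - {?F'})"
  have j: "inj_on j X" and j': "inj_on j' Y" for X Y
    unfolding j_def j'_def by (rule inj_on_glue[OF vs(1) vs'(1)])+
  have jj': "j a = j' b \<Longrightarrow> a \<in> set vs" for a b
    by (auto simp: j_def j'_def glue_eq_iff[OF vs(1) vs'(1)] dest: set_zip_leftD)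
  have eq: "map j vs = map j' vs'"
    unfolding j_def j'_def by (rule map_glue_eq) (use vs vs' in auto)
  have disj: "?A \<inter> ?B = {}"
  proof (rule ccontr)
    assume "?A \<inter> ?B \<noteq> {}"
    then obtain G G' where G: "G \<in> oriented_facets K" "G \<noteq> ?F" "map_osimp j G = map_osimp j' G'"
      by blast
    obtain us where us: "distinct us" "length us = d + 1" "G = osimplex us"
      using admissible_facet[OF K G(1)] by metis
    have "map j us \<in> map_osimp j' G'"
      using G(3) us(3) osimplex_refl by (metis map_osimp_osimplex)
    then obtain ws where "map j us = map j' ws" by (auto simp: map_osimp_def)
    then have "j ` set us = j' ` set ws" by (metis set_map)
    then have "\<exists>b. j a = j' b" if "a \<in> set us" for a
      using that by (metis image_iff)
    then have "set us \<subseteq> set vs" using jj' by blast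
    then have "set us = set vs"
      using us vs by (intro card_subset_eq) (auto simp: distinct_card)
    then have "G = ?F"
      using facet_unique[OF K G(1) F, of us vs] us(3) osimplex_refl by metis
    then show False using G(2) by simp
  qed
  have "complex_chain (connected_sum K vs K' vs') u
      = (\<Sum>G\<in>?A \<union> ?B. simplex_chain G u :: 'f)"
    unfolding complex_chain_def oriented_facets_connected_sum[OF K K' F F'] j_def j'_def ..
  also have "\<dots> = (\<Sum>G\<in>?A. simplex_chain G u) + (\<Sum>G\<in>?B. simplex_chain G u)"
    using finite_oriented_facets[OF K] finite_oriented_facets[OF K'] disj
    by (intro sum.union_disjoint) auto
  also have "\<dots> = push j (vertices K) (complex_chain K) u + push j' (vertices K') (complex_chain K') u
      - (simplex_chain (map_osimp j ?F) u + simplex_chain (map_osimp j' ?F') u)"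
    by (simp add: sum_map_osimp_remove[OF K j F] sum_map_osimp_remove[OF K' j' F'])
  also have "simplex_chain (map_osimp j ?F) u + simplex_chain (map_osimp j' ?F') u = (0 :: 'f)"
  proof -
    obtain us where us: "distinct us" "length us = d + 1" "set us \<subseteq> vertices K'" "?F' = osimplex us"
      using admissible_facet[OF K' F'] by metis
    have "set us = set vs'"
      using us(4) osimplex_refl mset_opposite mset_eq_setD by metis
    then have sub: "set vs' \<subseteq> vertices K'" using us by simp
    have "simplex_chain ?F' = (\<lambda>ws. 0 + (- 1) * (simplex_chain (osimplex vs') ws :: 'f))"
      by (simp add: fun_eq_iff simplex_chain_opposite[OF vs'(1) us(1,4,2)])
    then have "push j' (vertices K') (simplex_chain ?F') u
        = (push j' (vertices K') (\<lambda>ws. 0) u :: 'f) + (- 1) * push j' (vertices K') (simplex_chain (osimplex vs')) u"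
      by (simp only: push_lincomb)
    also have "push j' (vertices K') (\<lambda>ws. 0) u = (0 :: 'f)" by (simp add: push_def)
    also have "push j' (vertices K') (simplex_chain (osimplex vs'))
        = (simplex_chain (osimplex (map j' vs')) :: (_, 'f) chain)"
      by (rule push_simplex_chain[OF finite_vertices[OF K'] j' vs'(1) sub vs'(2)])
    finally show ?thesis
      by (simp add: push_facet[OF K' j' F'] map_osimp_osimplex eq)
  qed
  finally show "complex_chain (connected_sum K vs K' vs') u
    = (push j (vertices K) (complex_chain K) u + push j' (vertices K') (complex_chain K') u :: 'f)"
    by simp
qed

theorem theorem2:
  fixes d :: nat and K :: "'a ocomplex" and K' :: "'b ocomplex"
    and F :: "'a osimp" and F' :: "'b osimp" and vs :: "'a list" and vs' :: "'b list"
  assumes "d \<ge> 1"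
    and "admissible d K" and "admissible d K'"
    and "F \<in> oriented_facets K" and "F' \<in> oriented_facets K'"
    and "distinct vs" and "length vs = d + 1" and "F = osimplex vs"
    and "distinct vs'" and "length vs' = d + 1" and "F' = opposite (osimplex vs')"
  shows "(filling_volume d (connected_sum K vs K' vs') :: rat) =
    filling_volume d K + filling_volume d K'"
proof -
  note d = assms(1) and K = assms(2) and K' = assms(3)
  note vs = assms(6,7) and vs' = assms(9,10)
  have F: "osimplex vs \<in> oriented_facets K" and F': "opposite (osimplex vs') \<in> oriented_facets K'"
    using assms by auto
  let ?V = "vertices K" and ?V' = "vertices K'"
  let ?z = "complex_chain K :: ('a, rat) chain" and ?z' = "complex_chain K' :: ('b, rat) chain"
  define j where "j = glue vs vs' \<circ> Inl"
  define j' where "j' = glue vs vs' \<circ> Inr"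
  have fin: "finite ?V" "finite ?V'" by (rule finite_vertices[OF K], rule finite_vertices[OF K'])
  have vsV: "set vs \<subseteq> ?V" by (rule facet_lists(2)[OF K F osimplex_refl])
  have vsV': "set vs' \<subseteq> ?V'"
  proof -
    obtain us where us: "us \<in> opposite (osimplex vs')" using facet_nonempty[OF K' F'] by blast
    then have "set us = set vs'" by (metis mset_opposite mset_eq_setD)
    then show ?thesis using facet_lists(2)[OF K' F' us] by simp
  qed
  have x: "vs ! 0 \<in> ?V" "vs' ! 0 \<in> ?V'"
    using vsV vsV' vs(2) vs'(2) by (auto intro!: subsetD[OF vsV] subsetD[OF vsV'])
  note z = complex_chain_chains[OF K] boundary_complex_chain[OF K]
  note z' = complex_chain_chains[OF K'] boundary_complex_chain[OF K']
  obtain \<alpha> where \<alpha>: "minimal_filling (d + 1) ?V ?z \<alpha>"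
    using minimal_filling_exists[OF fin(1) x(1) z] by blast
  obtain \<alpha>' where \<alpha>': "minimal_filling (d + 1) ?V' ?z' \<alpha>'"
    using minimal_filling_exists[OF fin(2) x(2) z'] by blast
  have j: "inj_on j ?V" and j': "inj_on j' ?V'"
    unfolding j_def j'_def by (rule inj_on_glue[OF vs(1) vs'(1)])+
  have meet: "j ` ?V \<inter> j' ` ?V' \<subseteq> j ` set vs"
    by (auto simp: j_def j'_def glue_eq_iff[OF vs(1) vs'(1)] dest!: set_zip_leftD)
  have eq: "map j vs = map j' vs'"
    unfolding j_def j'_def by (rule map_glue_eq) (use vs vs' in auto)
  let ?\<gamma> = "\<lambda>u. push j ?V \<alpha> u + push j' ?V' \<alpha>' u"
  note glued = minimal_filling_glue[OF fin j j' vs(1) vsV vs(2) vs'(1) vsV' vs'(2) d eq meet z z' \<alpha> \<alpha>']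
  have "minimal_filling (d + 1) (vertices (connected_sum K vs K' vs'))
      (complex_chain (connected_sum K vs K' vs')) ?\<gamma>"
    unfolding vertices_connected_sum[OF d K K' vs vs'(1)]
      complex_chain_connected_sum[OF K K' F F' vs vs'] j_def[symmetric] j'_def[symmetric]
    by (rule glued(1))
  then have "filling_volume d (connected_sum K vs K' vs') = l1_norm ?\<gamma>"
    by (rule filling_volume_eq)
  also have "\<dots> = l1_norm \<alpha> + l1_norm \<alpha>'" by (rule glued(2))
  also have "l1_norm \<alpha> = filling_volume d K" by (rule filling_volume_eq[OF \<alpha>, symmetric])
  also have "l1_norm \<alpha>' = filling_volume d K'" by (rule filling_volume_eq[OF \<alpha>', symmetric])
  finally show ?thesis .
qed

end
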